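(* For all integers $a\geq 2$ and all $n\geq 503$, \[\mathrm{ex}_{\Pi}\Bigl(n, 6, \tbinom{6}{2}a +7\Bigr) = \Pi_{2,1}(a,n).\]
   Context: A multigraph is a pair $G=(V,w)$ where $V$ is a finite set and $w:\binom{V}{2}\to\mathbb{Z}_{\geq 0}$. For $X\subseteq V$ write $e(G[X])=\sum_{xy\in\binom{X}{2}}w(xy)$ and $P(G)=\prod_{xy\in\binom{V}{2}}w(xy)$. Given integers $s\geq 2$, $q\geq 0$, $\mathcal{F}(n,s,q)$ denotes the set of multigraphs on vertex set $[n]=\{1,\dots,n\}$ in which every $s$-set $X$ of vertices satisfies $e(G[X])\leq q$, and $\mathrm{ex}_{\Pi}(n,s,q)=\max\{P(G): G\in\mathcal{F}(n,s,q)\}$. For positive integers $a,r$, $d\in\{0,\dots,a-1\}$ and $n$, $\mathcal{T}_{r,d}(a,n)$ is the set of multigraphs $G$ on $[n]$ whose vertex set can be partitioned into $r$ parts $V_0,\dots,V_{r-1}$ such that all pairs inside $V_0$ have multiplicity $a-d$, all pairs inside $V_i$ ($1\le i\le r-1$) have multiplicity $a$, and all other pairs have multiplicity $a+1$. $\Pi_{r,d}(a,n)=\max\{P(G):G\in\mathcal{T}_{r,d}(a,n)\}$. *)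

theory Defs
  imports Main "HOL-Library.FuncSet" "HOL-Library.Disjoint_Sets" "HOL-Library.Ramsey"
begin

type_synonym 'a multigraph = "'a set \<times> ('a set \<Rightarrow> nat)"

abbreviation verts :: "'a multigraph \<Rightarrow> 'a set" where
  "verts G \<equiv> fst G"

abbreviation mult :: "'a multigraph \<Rightarrow> 'a set \<Rightarrow> nat" where
  "mult G \<equiv> snd G"

text \<open>The multiplicity function has domain the set of all 2-element subsets of the vertex set;
  being extensional, it carries no further information outside that domain.\<close>

definition multigraph :: "'a multigraph \<Rightarrow> bool" where
  "multigraph G \<longleftrightarrow> finite (verts G) \<and> mult G \<in> nsets (verts G) 2 \<rightarrow>\<^sub>E UNIV"

definition edge_sum :: "'a multigraph \<Rightarrow> 'a set \<Rightarrow> nat" where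
  "edge_sum G X = (\<Sum>e\<in>nsets X 2. mult G e)"

definition edge_prod :: "'a multigraph \<Rightarrow> nat" where
  "edge_prod G = (\<Prod>e\<in>nsets (verts G) 2. mult G e)"

definition sq_graphs :: "nat \<Rightarrow> nat \<Rightarrow> nat \<Rightarrow> nat multigraph set" where
  "sq_graphs n s q =
    {G. multigraph G \<and> verts G = {1..n} \<and> (\<forall>X\<in>nsets {1..n} s. edge_sum G X \<le> q)}"

text \<open>For \<open>n < s\<close> the condition on \<open>s\<close>-sets is vacuous and, once \<open>n \<ge> 2\<close>, the set of products is
  unbounded, so that \<open>Max\<close> is unspecified; the maximum exists whenever \<open>2 \<le> s \<le> n\<close>, as shown below.\<close>

definition ex_Pi :: "nat \<Rightarrow> nat \<Rightarrow> nat \<Rightarrow> nat" where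
  "ex_Pi n s q = Max (edge_prod ` sq_graphs n s q)"

text \<open>Parts are allowed to be empty.\<close>

definition T_graphs :: "nat \<Rightarrow> nat \<Rightarrow> nat \<Rightarrow> nat \<Rightarrow> nat multigraph set" where
  "T_graphs r d a n =
    {G. multigraph G \<and> verts G = {1..n} \<and>
      (\<exists>V :: nat \<Rightarrow> nat set.
        disjoint_family_on V {..<r} \<and> (\<Union>i<r. V i) = {1..n} \<and>
        (\<forall>e\<in>nsets (V 0) 2. mult G e = a - d) \<and>
        (\<forall>i\<in>{1..<r}. \<forall>e\<in>nsets (V i) 2. mult G e = a) \<and>
        (\<forall>e\<in>nsets {1..n} 2. (\<forall>i<r. \<not> e \<subseteq> V i) \<longrightarrow> mult G e = a + 1))}"

definition Pi_T :: "nat \<Rightarrow> nat \<Rightarrow> nat \<Rightarrow> nat \<Rightarrow> nat" where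
  "Pi_T r d a n = Max (edge_prod ` T_graphs r d a n)"

lemma finite_sq_graphs:
  assumes "2 \<le> s" "s \<le> n"
  shows "finite (sq_graphs n s q)"
proof (rule finite_subset)
  show "sq_graphs n s q \<subseteq> {{1..n}} \<times> (nsets {1..n} 2 \<rightarrow>\<^sub>E {..q})"
  proof
    fix G assume G: "G \<in> sq_graphs n s q"
    have "mult G e \<le> q" if e: "e \<in> nsets {1..n} 2" for e
    proof -
      obtain X where X: "e \<subseteq> X" "X \<subseteq> {1..n}" "card X = s"
        using exists_subset_between[of e s "{1..n}"] e assms by (auto simp: nsets_def)
      then have "finite X" by (auto intro: finite_subset)
      then have "mult G e \<le> edge_sum G X"
        unfolding edge_sum_def using X e
        by (intro member_le_sum) (auto simp: nsets_def)
      also have "\<dots> \<le> q"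
        using G X \<open>finite X\<close> by (auto simp: sq_graphs_def nsets_def)
      finally show ?thesis .
    qed
    with G show "G \<in> {{1..n}} \<times> (nsets {1..n} 2 \<rightarrow>\<^sub>E {..q})"
      by (cases G) (auto simp: sq_graphs_def multigraph_def PiE_iff)
  qed
  show "finite ({{1..n}} \<times> (nsets {1..n} 2 \<rightarrow>\<^sub>E {..q}))"
    by (auto intro!: finite_PiE finite_imp_finite_nsets)
qed

lemma sq_graphs_nonempty: "sq_graphs n s q \<noteq> {}"
proof -
  let ?G = "({1..n}, \<lambda>e\<in>nsets {1..n} 2. 0)"
  have "edge_sum ?G X = 0" if "X \<in> nsets {1..n} s" for X
    unfolding edge_sum_def using that by (intro sum.neutral) (auto simp: nsets_def)
  then have "?G \<in> sq_graphs n s q"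
    by (auto simp: sq_graphs_def multigraph_def)
  then show ?thesis by blast
qed

lemma finite_T_graphs: "finite (T_graphs r d a n)"
proof (rule finite_subset)
  show "T_graphs r d a n \<subseteq> {{1..n}} \<times> (nsets {1..n} 2 \<rightarrow>\<^sub>E {a - d, a, a + 1})"
  proof
    fix G assume "G \<in> T_graphs r d a n"
    then obtain V :: "nat \<Rightarrow> nat set" where mg: "multigraph G" "verts G = {1..n}"
      and V: "\<forall>e\<in>nsets (V 0) 2. mult G e = a - d"
        "\<forall>i\<in>{1..<r}. \<forall>e\<in>nsets (V i) 2. mult G e = a"
        "\<forall>e\<in>nsets {1..n} 2. (\<forall>i<r. \<not> e \<subseteq> V i) \<longrightarrow> mult G e = a + 1"
      unfolding T_graphs_def by blast
    have "mult G e \<in> {a - d, a, a + 1}" if e: "e \<in> nsets {1..n} 2" for e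
    proof (cases "\<exists>i<r. e \<subseteq> V i")
      case True
      then obtain i where i: "i < r" "e \<in> nsets (V i) 2" using e by (auto simp: nsets_def)
      then show ?thesis using V by (cases "i = 0") auto
    next
      case False
      then show ?thesis using V e by blast
    qed
    with mg show "G \<in> {{1..n}} \<times> (nsets {1..n} 2 \<rightarrow>\<^sub>E {a - d, a, a + 1})"
      by (cases G) (auto simp: multigraph_def PiE_iff)
  qed
  show "finite ({{1..n}} \<times> (nsets {1..n} 2 \<rightarrow>\<^sub>E {a - d, a, a + 1}))"
    by (auto intro!: finite_PiE finite_imp_finite_nsets)
qed

lemma T_graphs_nonempty:
  assumes "1 \<le> r"
  shows "T_graphs r d a n \<noteq> {}"
proof -
  have "({1..n}, \<lambda>e\<in>nsets {1..n} 2. a - d) \<in> T_graphs r d a n"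
    unfolding T_graphs_def using assms
    by (auto simp: multigraph_def nsets_def disjoint_family_on_def
        intro!: exI[of _ "\<lambda>i. if i = 0 then {1..n} else {}"] split: if_splits)
  then show ?thesis by blast
qed

end

(* Measure a multigraph by its logarithmic gain over the constant multiplicity a, in units of
   ln ((a + 1) / a): an edge of multiplicity w then contributes at most w - a, and at most
   -kappa if w < a, where kappa = ln (a / (a - 1)) / ln ((a + 1) / a) lies between 1 and
   12/7 (for a = 2 because 2^19 < 3^12).

   If some 5-, 4-, 3- or 2-set spans more than 10a+5, 6a+3, 3a+2 or a+1 edges (the largest of these
   that occurs), every outside vertex sends so few edges to it that deleting it loses strictly
   against the conjectured optimum; this is iterated. Otherwise the pairs of multiplicity a+1 form
   a triangle-free graph H in which every 4-cycle has a diagonal in the graph L of pairs of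
   multiplicity less than a. Put weights on the vertices and maximise the gain of the blow-up,
   where copies of one vertex are joined by light edges. The gain is affine along light edges, so a
   maximiser of minimal support has none in its support, where H therefore has girth at least 5.
   All weighted degrees are almost equal at a maximiser, and counting paths of length two from a
   vertex (the Moore bound) shows that every class is a leaf or large, which leaves only stars. *)

theory Submission
  imports Defs Complex_Main
begin

section \<open>Sums over pairs\<close>

lemma sum_nsets_insert:
  assumes "finite A" "x \<notin> A"
  shows "(\<Sum>e\<in>nsets (insert x A) 2. f e) = (\<Sum>e\<in>nsets A 2. f e) + (\<Sum>y\<in>A. f {x, y})"
proof -
  have "nsets (insert x A) 2 = nsets A 2 \<union> (\<lambda>y. {x, y}) ` A"
  proof (intro equalityI subsetI)
    fix e assume e: "e \<in> nsets (insert x A) 2"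
    then obtain p q where pq: "e = {p, q}" "p \<noteq> q" "p \<in> insert x A" "q \<in> insert x A"
      unfolding nsets_def by (auto simp: card_2_iff)
    then show "e \<in> nsets A 2 \<union> (\<lambda>y. {x, y}) ` A"
      by (auto simp: nsets_def doubleton_eq_iff)
  next
    fix e assume "e \<in> nsets A 2 \<union> (\<lambda>y. {x, y}) ` A"
    then show "e \<in> nsets (insert x A) 2" using assms by (auto simp: nsets_def card_insert_if)
  qed
  moreover have "nsets A 2 \<inter> (\<lambda>y. {x, y}) ` A = {}" using assms by (auto simp: nsets_def)
  moreover have "inj_on (\<lambda>y. {x, y}) A" by (auto simp: inj_on_def doubleton_eq_iff)
  moreover have "finite (nsets A 2)" using assms finite_imp_finite_nsets by blast
  ultimately show ?thesis using assms
    by (simp add: sum.union_disjoint sum.reindex)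
qed

lemma sum_nsets_Un:
  assumes "finite A" "finite B" "A \<inter> B = {}"
  shows "(\<Sum>e\<in>nsets (A \<union> B) 2. f e)
    = (\<Sum>e\<in>nsets A 2. f e) + (\<Sum>e\<in>nsets B 2. f e) + (\<Sum>x\<in>A. \<Sum>y\<in>B. f {x, y})"
  using assms
proof (induction A rule: finite_induct)
  case empty
  have "nsets {} 2 = ({} :: 'a set set)" by (auto simp: nsets_def)
  then show ?case by simp
next
  case (insert x A)
  have "(\<Sum>e\<in>nsets (insert x A \<union> B) 2. f e) = (\<Sum>e\<in>nsets (A \<union> B) 2. f e) + (\<Sum>y\<in>A \<union> B. f {x, y})"
    using insert sum_nsets_insert[of "A \<union> B" x f] by simp
  also have "(\<Sum>y\<in>A \<union> B. f {x, y}) = (\<Sum>y\<in>A. f {x, y}) + (\<Sum>y\<in>B. f {x, y})"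
    using insert by (intro sum.union_disjoint) auto
  finally show ?case
    using insert sum_nsets_insert[of A x f] by (simp add: algebra_simps)
qed

lemma sum_nsets_handshake:
  fixes f :: "'a set \<Rightarrow> real"
  assumes "finite A"
  shows "(\<Sum>x\<in>A. \<Sum>y\<in>A - {x}. f {x, y}) = 2 * (\<Sum>e\<in>nsets A 2. f e)"
  using assms
proof (induction A rule: finite_induct)
  case empty
  have "nsets {} 2 = ({} :: 'a set set)" by (auto simp: nsets_def)
  then show ?case by simp
next
  case (insert z A)
  have "(\<Sum>y\<in>insert z A - {x}. f {x, y}) = (\<Sum>y\<in>A - {x}. f {x, y}) + f {z, x}" if "x \<in> A" for x
  proof -
    have "insert z A - {x} = insert z (A - {x})" using that insert by auto
    then show ?thesis using insert by (simp add: insert_commute)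
  qed
  then have "(\<Sum>x\<in>A. \<Sum>y\<in>insert z A - {x}. f {x, y})
      = (\<Sum>x\<in>A. \<Sum>y\<in>A - {x}. f {x, y}) + (\<Sum>x\<in>A. f {z, x})"
    by (simp add: sum.distrib)
  moreover have "insert z A - {z} = A" using insert by auto
  ultimately show ?case using insert by (simp add: sum_nsets_insert)
qed

lemma sum_nsets_remove:
  fixes f :: "'a set \<Rightarrow> real"
  assumes "finite A" "x \<in> A"
  shows "(\<Sum>e\<in>nsets A 2. f e) = (\<Sum>e\<in>nsets (A - {x}) 2. f e) + (\<Sum>y\<in>A - {x}. f {x, y})"
  using sum_nsets_insert[of "A - {x}" x f] assms by (simp add: insert_absorb)

text \<open>Induction on \<open>card V\<close>: a pair survives in m - 2 of the m vertex deletions,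
  so averaging the bounds for \<open>V - {x}\<close> gives the one for \<open>V\<close>. With the
  scaling s(s - 1), \<open>q\<close> bounds half the mean weight per pair.\<close>

lemma sum_nsets_average:
  fixes f :: "'a set \<Rightarrow> real"
  assumes "finite V" "2 \<le> s" "s \<le> card V"
    and "\<And>X. X \<subseteq> V \<Longrightarrow> card X = s \<Longrightarrow> (\<Sum>e\<in>nsets X 2. f e) \<le> q * (real s * (real s - 1))"
  shows "(\<Sum>e\<in>nsets V 2. f e) \<le> q * (real (card V) * (real (card V) - 1))"
  using assms
proof (induction "card V" arbitrary: V rule: less_induct)
  case less
  show ?case
  proof (cases "card V = s")
    case True
    then show ?thesis using less.prems(4)[of V] by simp
  next
    case False
    define m where "m = card V"
    have m: "s < m" "m \<ge> 3" using False less.prems m_def by auto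
    let ?t = "(\<Sum>e\<in>nsets V 2. f e)"
    have "(\<Sum>e\<in>nsets (V - {x}) 2. f e) \<le> q * ((real m - 1) * (real m - 2))" if "x \<in> V" for x
    proof -
      have c: "card (V - {x}) = m - 1" using that m_def less.prems by simp
      have "(\<Sum>e\<in>nsets (V - {x}) 2. f e) \<le> q * (real (card (V - {x})) * (real (card (V - {x})) - 1))"
        by (rule less.hyps) (use c m m_def less.prems in auto)
      then show ?thesis using c m by (simp add: of_nat_diff algebra_simps)
    qed
    then have "(\<Sum>x\<in>V. \<Sum>e\<in>nsets (V - {x}) 2. f e) \<le> real m * (q * ((real m - 1) * (real m - 2)))"
      unfolding m_def by (intro sum_bounded_above) auto
    moreover have "(\<Sum>x\<in>V. \<Sum>e\<in>nsets (V - {x}) 2. f e) = (real m - 2) * ?t"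
    proof -
      have "(\<Sum>x\<in>V. \<Sum>e\<in>nsets (V - {x}) 2. f e) = (\<Sum>x\<in>V. ?t - (\<Sum>y\<in>V - {x}. f {x, y}))"
        using sum_nsets_remove[OF less.prems(1)] by (intro sum.cong) (auto simp: algebra_simps)
      also have "\<dots> = real m * ?t - 2 * ?t"
        using sum_nsets_handshake[OF less.prems(1), of f] by (simp add: sum_subtractf m_def)
      finally show ?thesis by (simp add: algebra_simps)
    qed
    ultimately have "(real m - 2) * ?t \<le> (real m - 2) * (q * (real m * (real m - 1)))"
      by (simp add: algebra_simps)
    then show ?thesis using m by (simp add: m_def)
  qed
qed

section \<open>The gain of the extremal construction\<close>

text \<open>\<open>split_gain \<kappa> n x\<close> is the logarithmic gain over the constant multiplicity \<open>a\<close>, in units of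
  \<open>ln ((a + 1) / a)\<close>, of the extremal construction with \<open>x\<close> vertices in \<open>V\<^sub>0\<close>; here \<open>\<kappa>\<close> is
  \<open>ln (a / (a - 1)) / ln ((a + 1) / a)\<close>.\<close>

definition split_gain :: "real \<Rightarrow> nat \<Rightarrow> nat \<Rightarrow> real" where
  "split_gain \<kappa> n x = real x * (real n - real x) - \<kappa> * (real x * (real x - 1) / 2)"

definition opt_gain :: "real \<Rightarrow> nat \<Rightarrow> real" where
  "opt_gain \<kappa> n = Max (split_gain \<kappa> n ` {..n})"

lemma split_gain_le_opt: "x \<le> n \<Longrightarrow> split_gain \<kappa> n x \<le> opt_gain \<kappa> n"
  unfolding opt_gain_def by (rule Max_ge) auto

text \<open>The lower bound on \<open>x\<close> is local optimality: the forward difference of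
  \<open>split_gain\<close> at \<open>x\<close> is n - 1 - (2 + \<kappa>) x, which cannot be
  positive at a maximiser below \<open>n\<close>.\<close>

lemma opt_gain_attained:
  assumes "0 \<le> \<kappa>"
  obtains x where "x \<le> n" "opt_gain \<kappa> n = split_gain \<kappa> n x" "(real n - 1) / (2 + \<kappa>) \<le> real x"
proof -
  have "opt_gain \<kappa> n \<in> split_gain \<kappa> n ` {..n}"
    unfolding opt_gain_def by (rule Max_in) auto
  then obtain x where x: "x \<le> n" "opt_gain \<kappa> n = split_gain \<kappa> n x" by auto
  have "real n - 1 \<le> (2 + \<kappa>) * real x"
  proof (cases "x = n")
    case True
    then show ?thesis using assms by (simp add: algebra_simps)
  next
    case False
    then have "split_gain \<kappa> n (x + 1) \<le> split_gain \<kappa> n x"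
      using split_gain_le_opt[of "x + 1" n \<kappa>] x by simp
    moreover have "split_gain \<kappa> n (x + 1) = split_gain \<kappa> n x + (real n - 1 - (2 + \<kappa>) * real x)"
      unfolding split_gain_def by (simp add: field_simps)
    ultimately show ?thesis by simp
  qed
  then have "(real n - 1) / (2 + \<kappa>) \<le> real x" using assms by (simp add: field_simps)
  with x that show ?thesis by blast
qed

text \<open>In \<open>x\<close>, \<open>split_gain\<close> is a concave parabola with apex
  \<open>y\<close> and height (n + \<kappa>/2)^2 / (2 (2 + \<kappa>)). Rounding \<open>y\<close> to
  an integer costs at most (2 + \<kappa>)/8 \<le> 1/2, and \<kappa>^2/4 is dropped from the
  numerator.\<close>

lemma opt_gain_lower:
  assumes "0 \<le> \<kappa>" "\<kappa> \<le> 2" "1 \<le> n"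
  shows "opt_gain \<kappa> n \<ge> (real n * real n + \<kappa> * real n) / (2 * (2 + \<kappa>)) - 1 / 2"
proof -
  define y where "y = (real n + \<kappa> / 2) / (2 + \<kappa>)"
  define x where "x = nat (round y)"
  have y0: "0 \<le> y" using assms by (simp add: y_def)
  then have rx: "real x = of_int (round y)"
    unfolding x_def using round_mono[of 0 y] by simp
  have d: "\<bar>real x - y\<bar> \<le> 1 / 2"
    unfolding rx using of_int_round_abs_le by blast
  have "\<kappa> \<le> \<kappa> * real n" using assms mult_left_mono[of 1 "real n" \<kappa>] by simp
  then have "real n + \<kappa> / 2 \<le> real n * (2 + \<kappa>)"
    using assms by (simp add: algebra_simps)
  then have "y \<le> real n" unfolding y_def using assms by (simp add: divide_le_eq)
  then have "real x < real n + 1" using d by linarith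
  then have "x \<le> n" by linarith
  have "split_gain \<kappa> n x = (2 + \<kappa>) / 2 * (y * y) - (2 + \<kappa>) / 2 * ((real x - y) * (real x - y))"
  proof -
    have "(2 + \<kappa>) * y = real n + \<kappa> / 2" using assms by (simp add: y_def)
    moreover have "split_gain \<kappa> n x = (real n + \<kappa> / 2) * real x - (2 + \<kappa>) / 2 * (real x * real x)"
      unfolding split_gain_def by (simp add: field_simps)
    ultimately have "split_gain \<kappa> n x = (2 + \<kappa>) * y * real x - (2 + \<kappa>) / 2 * (real x * real x)"
      by simp
    then show ?thesis by (simp add: field_simps)
  qed
  moreover have "(real x - y) * (real x - y) \<le> 1 / 4"
    using d abs_le_square_iff[of "real x - y" "1 / 2"] by (simp add: power2_eq_square)
  then have "(2 + \<kappa>) / 2 * ((real x - y) * (real x - y)) \<le> 1 / 2"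
    using assms mult_mono[of "(2 + \<kappa>) / 2" 2 "(real x - y) * (real x - y)" "1 / 4"] by simp
  moreover have "(2 + \<kappa>) / 2 * (y * y) \<ge> (real n * real n + \<kappa> * real n) / (2 * (2 + \<kappa>))"
  proof -
    have "(2 + \<kappa>) / 2 * (y * y) = (real n + \<kappa> / 2) * (real n + \<kappa> / 2) / (2 * (2 + \<kappa>))"
    proof -
      have "(2 + \<kappa>) * y = real n + \<kappa> / 2" using assms by (simp add: y_def)
      then have "(real n + \<kappa> / 2) * (real n + \<kappa> / 2) = (2 + \<kappa>) * ((2 + \<kappa>) * (y * y))"
        by (metis mult.assoc mult.left_commute)
      then have "(real n + \<kappa> / 2) * (real n + \<kappa> / 2) / (2 * (2 + \<kappa>))
          = (2 + \<kappa>) * ((2 + \<kappa>) * (y * y)) / ((2 + \<kappa>) * 2)" by (simp only: mult.commute)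
      also have "\<dots> = (2 + \<kappa>) * (y * y) / 2"
        using assms by (subst mult_divide_mult_cancel_left) auto
      finally show ?thesis by simp
    qed
    moreover have "(real n + \<kappa> / 2) * (real n + \<kappa> / 2) \<ge> real n * real n + \<kappa> * real n"
      by (simp add: algebra_simps)
    ultimately show ?thesis using assms by (simp only:) (intro divide_right_mono; simp)
  qed
  ultimately show ?thesis
    using split_gain_le_opt[OF \<open>x \<le> n\<close>, of \<kappa>] by linarith
qed

text \<open>Here \<open>t\<close> is the bound from \<open>gain_remove_heavy_set\<close> on the gain
  lost with a heavy k-set, and the term with 3/500 covers the growth of \<open>slack\<close> under
  the deletion. The optimum on m - k vertices is enlarged by k vertices in one of two ways; a lower
  bound on \<open>x\<close> then suffices.\<close>

lemma opt_gain_step: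
  fixes k t :: nat
  assumes \<kappa>: "1 \<le> \<kappa>" "\<kappa> \<le> 12 / 7" and m: "100 \<le> m"
    and kt: "(k = 5 \<and> t = m + 1) \<or> (k = 4 \<and> t = m) \<or> (k = 3 \<and> t = 3) \<or> (k = 2 \<and> t = 2)"
  shows "opt_gain \<kappa> (m - k) + real t + 3 / 500 * (real m ^ 2 - real (m - k) ^ 2) \<le> opt_gain \<kappa> m"
proof -
  obtain x where x: "x \<le> m - k" "opt_gain \<kappa> (m - k) = split_gain \<kappa> (m - k) x"
    "(real (m - k) - 1) / (2 + \<kappa>) \<le> real x"
    by (rule opt_gain_attained[of \<kappa> "m - k"]) (use \<kappa> in auto)
  have k5: "2 \<le> k" "k \<le> 5" using kt by auto
  have mk: "real (m - k) = real m - real k" using k5 m by (simp add: of_nat_diff)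
  \<comment> \<open>7/26 is 1/(2 + \<kappa>) at the largest admissible value \<kappa> =
    12/7.\<close>
  have x_ge: "7 / 26 * (real m - real k - 1) \<le> real x"
  proof -
    have "7 / 26 \<le> 1 / (2 + \<kappa>)" using \<kappa> by (simp add: field_simps)
    then have "7 / 26 * (real m - real k - 1) \<le> 1 / (2 + \<kappa>) * (real m - real k - 1)"
      using k5 m by (intro mult_right_mono) auto
    moreover have "1 / (2 + \<kappa>) * (real m - real k - 1) \<le> real x" using x(3) mk by simp
    ultimately show ?thesis by linarith
  qed
  have sq: "3 / 500 * (real m ^ 2 - real (m - k) ^ 2) = 3 / 500 * (2 * real k * real m - real k * real k)"
    unfolding mk by (simp add: power2_eq_square algebra_simps)
  \<comment> \<open>All k new vertices join the part of multiplicity \<open>a\<close>.\<close>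
  have same: "opt_gain \<kappa> m \<ge> opt_gain \<kappa> (m - k) + real k * real x"
  proof -
    have "split_gain \<kappa> m x = split_gain \<kappa> (m - k) x + real k * real x"
      unfolding split_gain_def mk by (simp add: algebra_simps)
    then show ?thesis using split_gain_le_opt[of x m \<kappa>] x by simp
  qed
  \<comment> \<open>One new vertex joins \<open>V\<^sub>0\<close> and the other k - 1 join the part
    of multiplicity \<open>a\<close>. This gives the full linear term needed for k = 4 and k = 5.
    For k = 4 the surplus is (2 - \<kappa>) x, which is where 12/7 < 2 enters.\<close>
  have up: "opt_gain \<kappa> m \<ge> opt_gain \<kappa> (m - k) + (real m - 1 + (real k - 2 - \<kappa>) * real x)"
  proof -
    have "split_gain \<kappa> m (x + 1) = split_gain \<kappa> (m - k) x + (real m - 1 + (real k - 2 - \<kappa>) * real x)"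
      unfolding split_gain_def mk by (simp add: field_simps)
    then show ?thesis using split_gain_le_opt[of "x + 1" m \<kappa>] x k5 m by simp
  qed
  consider "k = 5" "t = m + 1" | "k = 4" "t = m" | "k = 3" "t = 3" | "k = 2" "t = 2"
    using kt by blast
  then show ?thesis
  proof cases
    case 1
    have "9 / 7 * real x \<le> (real k - 2 - \<kappa>) * real x" using \<kappa> 1 by (intro mult_right_mono) auto
    then have "real m - 1 + 9 / 7 * real x \<le> opt_gain \<kappa> m - opt_gain \<kappa> (m - k)" using up by linarith
    moreover have "3 / 500 * (2 * real k * real m - real k * real k) = 3 / 50 * real m - 3 / 20"
      "7 / 26 * (real m - real k - 1) = 7 / 26 * real m - 7 / 26 * 6" "real t = real m + 1"
      using 1 by simp_all
    ultimately show ?thesis unfolding sq using x_ge m by linarith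
  next
    case 2
    have "2 / 7 * real x \<le> (real k - 2 - \<kappa>) * real x" using \<kappa> 2 by (intro mult_right_mono) auto
    then have "real m - 1 + 2 / 7 * real x \<le> opt_gain \<kappa> m - opt_gain \<kappa> (m - k)" using up by linarith
    moreover have "3 / 500 * (2 * real k * real m - real k * real k) = 6 / 125 * real m - 12 / 125"
      "7 / 26 * (real m - real k - 1) = 7 / 26 * real m - 7 / 26 * 5" "real t = real m + 0"
      using 2 by simp_all
    ultimately show ?thesis unfolding sq using x_ge m by linarith
  next
    case 3
    then have "opt_gain \<kappa> (m - k) + 3 * real x \<le> opt_gain \<kappa> m" using same by simp
    moreover have "3 / 500 * (2 * real k * real m - real k * real k) = 9 / 250 * real m - 27 / 500"
      "7 / 26 * (real m - real k - 1) = 7 / 26 * real m - 7 / 26 * 4" "real t = 3"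
      using 3 by simp_all
    ultimately show ?thesis unfolding sq using x_ge m by linarith
  next
    case 4
    then have "opt_gain \<kappa> (m - k) + 2 * real x \<le> opt_gain \<kappa> m" using same by simp
    moreover have "3 / 500 * (2 * real k * real m - real k * real k) = 3 / 125 * real m - 3 / 125"
      "7 / 26 * (real m - real k - 1) = 7 / 26 * real m - 7 / 26 * 3" "real t = 2"
      using 4 by simp_all
    ultimately show ?thesis unfolding sq using x_ge m by linarith
  qed
qed

section \<open>Weighted graphs of girth at least five\<close>

definition quad_form :: "('a \<Rightarrow> 'a \<Rightarrow> real) \<Rightarrow> 'a set \<Rightarrow> ('a \<Rightarrow> real) \<Rightarrow> real" where
  "quad_form B V c = (\<Sum>x\<in>V. \<Sum>y\<in>V. c x * c y * B x y)"

lemma sum_two_point: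
  fixes f :: "'a \<Rightarrow> real"
  assumes "finite V" "x \<in> V" "y \<in> V"
  shows "(\<Sum>z\<in>V. t * (of_bool (z = y) - of_bool (z = x)) * f z) = t * (f y - f x)"
proof -
  have "(\<Sum>z\<in>V. t * (of_bool (z = y) - of_bool (z = x)) * f z)
      = (\<Sum>z\<in>V. (if z = y then t * f z else 0)) - (\<Sum>z\<in>V. (if z = x then t * f z else 0))"
    unfolding sum_subtractf[symmetric] by (intro sum.cong) (auto simp: algebra_simps)
  then show ?thesis using assms by (simp add: right_diff_distrib)
qed

text \<open>The second-order expansion is exact because the form is quadratic. \<open>g\<close> is
  half its gradient at \<open>c\<close>, and the last bracket is the form evaluated at the direction
  of the transfer.\<close>

lemma quad_form_shift:
  fixes c :: "'a \<Rightarrow> real"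
  assumes V: "finite V" "x \<in> V" "y \<in> V" "x \<noteq> y"
    and sym: "\<And>p q. p \<in> V \<Longrightarrow> q \<in> V \<Longrightarrow> B p q = B q p"
  defines "g \<equiv> \<lambda>z. \<Sum>k\<in>V. c k * B z k"
  shows "quad_form B V (c(x := c x - t, y := c y + t))
    = quad_form B V c + 2 * t * (g y - g x) + t * t * (B y y - 2 * B x y + B x x)"
proof -
  define d where "d = (\<lambda>z. t * (of_bool (z = y) - of_bool (z = x)) :: real)"
  have d: "(\<Sum>z\<in>V. d z * f z) = t * (f y - f x)" for f
    unfolding d_def using sum_two_point[OF V(1-3)] .
  have "c(x := c x - t, y := c y + t) = (\<lambda>z. c z + d z)"
    using V by (auto simp: d_def)
  then have "quad_form B V (c(x := c x - t, y := c y + t))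
      = (\<Sum>p\<in>V. \<Sum>q\<in>V. c p * c q * B p q + c q * (d p * B p q) + d q * (c p * B p q) + d q * (d p * B p q))"
    unfolding quad_form_def by (simp add: algebra_simps)
  also have "\<dots> = quad_form B V c + (\<Sum>p\<in>V. d p * g p)
      + (\<Sum>p\<in>V. c p * (\<Sum>q\<in>V. d q * B p q)) + (\<Sum>p\<in>V. d p * (\<Sum>q\<in>V. d q * B p q))"
    unfolding quad_form_def g_def
    by (simp add: sum.distrib sum_distrib_left algebra_simps)
  also have "(\<Sum>p\<in>V. c p * (\<Sum>q\<in>V. d q * B p q)) = t * (g y - g x)"
  proof -
    have "(\<Sum>p\<in>V. c p * (\<Sum>q\<in>V. d q * B p q)) = (\<Sum>p\<in>V. t * (c p * B y p - c p * B x p))"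
      unfolding d using sym V by (intro sum.cong) (auto simp: algebra_simps)
    also have "\<dots> = t * (g y - g x)"
      unfolding g_def by (simp add: sum_distrib_left sum_subtractf right_diff_distrib)
    finally show ?thesis .
  qed
  also have "(\<Sum>p\<in>V. d p * g p) = t * (g y - g x)" by (rule d)
  also have "(\<Sum>p\<in>V. d p * (\<Sum>q\<in>V. d q * B p q)) = t * t * (B y y - 2 * B x y + B x x)"
    unfolding d using sym[of x y] V by (simp add: algebra_simps)
  finally show ?thesis by (simp add: algebra_simps del: fun_upd_apply)
qed

text \<open>A class \<open>j\<close> of weight about \<open>\<mu>\<close> or more has weighted
  degree at least about (1 + \<kappa>) \<open>\<mu>\<close>, while n exceeds (2 + \<kappa>)
  \<open>\<mu>\<close> by at most a constant. So only bounded weight lies outside \<open>j\<close>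
  and its neighbours. A class there would be a leaf on another heavy class \<open>l\<close> adjacent
  to \<open>j\<close>, and the disjoint neighbourhoods of \<open>j\<close> and \<open>l\<close>
  would together outweigh n.\<close>

lemma star_structure:
  fixes c :: "'a \<Rightarrow> real" and \<kappa> \<mu> :: real
  assumes I: "finite I" "I \<noteq> {}" and c1: "\<And>x. x \<in> I \<Longrightarrow> 1 \<le> c x"
    and symH: "\<And>x y. x \<in> I \<Longrightarrow> y \<in> I \<Longrightarrow> H x y \<Longrightarrow> H y x"
    and irr: "\<And>x. x \<in> I \<Longrightarrow> \<not> H x x"
    and tri: "\<And>x y z. x \<in> I \<Longrightarrow> y \<in> I \<Longrightarrow> z \<in> I \<Longrightarrow> H x y \<Longrightarrow> H y z \<Longrightarrow> \<not> H x z"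
    and c4: "\<And>x y z t. x \<in> I \<Longrightarrow> y \<in> I \<Longrightarrow> z \<in> I \<Longrightarrow> t \<in> I \<Longrightarrow>
       x \<noteq> y \<Longrightarrow> H x z \<Longrightarrow> H z y \<Longrightarrow> H x t \<Longrightarrow> H t y \<Longrightarrow> z = t"
    and n: "n = sum c I" "100 \<le> n" and \<kappa>: "1 \<le> \<kappa>" "\<kappa> \<le> 12 / 7"
    and \<mu>: "n / (2 + \<kappa>) - 5 / 2 \<le> \<mu>"
  defines "N \<equiv> \<lambda>x. {y \<in> I. H x y}"
  assumes deg: "\<And>x. x \<in> I \<Longrightarrow> \<mu> + \<kappa> * (c x - 1) \<le> sum c (N x)"
  shows "\<exists>j\<in>I. I = insert j (N j)"
proof -
  define D where "D = (\<lambda>x. sum c (N x))"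
  have finN: "finite (N x)" for x using I by (simp add: N_def)
  have NI: "N x \<subseteq> I" for x by (auto simp: N_def)
  have cpos: "x \<in> I \<Longrightarrow> 0 \<le> c x" for x using c1[of x] by simp
  have sub_le: "sum c A \<le> sum c B'" if "A \<subseteq> B'" "B' \<subseteq> I" for A B'
    using that I cpos finite_subset by (intro sum_mono2) blast+
  have D: "\<mu> + \<kappa> * (c x - 1) \<le> D x" if "x \<in> I" for x using deg that by (simp add: D_def)
  have kc: "0 \<le> \<kappa> * (c x - 1)" if "x \<in> I" for x using \<kappa> c1[OF that] by simp
  have n\<mu>: "n \<le> 2 * \<mu> + \<kappa> * \<mu> + 5 + 5 / 2 * \<kappa>"
  proof -
    have "(2 + \<kappa>) * (n / (2 + \<kappa>) - 5 / 2) \<le> (2 + \<kappa>) * \<mu>"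
      using \<mu> \<kappa> by (intro mult_left_mono) auto
    moreover have "(2 + \<kappa>) * (n / (2 + \<kappa>) - 5 / 2) = n - 5 - 5 / 2 * \<kappa>"
      using \<kappa> by (simp add: field_simps)
    moreover have "(2 + \<kappa>) * \<mu> = 2 * \<mu> + \<kappa> * \<mu>" by (rule distrib_right)
    ultimately show ?thesis by linarith
  qed
  \<comment> \<open>At n = 100 and \<kappa> = 12/7 the lower bound n/(2 + \<kappa>) - 5/2 is about
    24.4.\<close>
  have \<mu>24: "24 \<le> \<mu>"
  proof (rule ccontr)
    assume "\<not> 24 \<le> \<mu>"
    then have "\<kappa> * \<mu> \<le> \<kappa> * 24" "\<mu> \<le> 24" using \<kappa> by (auto intro: mult_left_mono)
    then show False using n\<mu> n(2) \<kappa> by linarith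
  qed
  have k\<mu>: "24 * \<kappa> \<le> \<kappa> * \<mu>" "\<mu> \<le> \<kappa> * \<mu>" "\<kappa> * \<mu> \<le> 12 / 7 * \<mu>"
    using \<kappa> \<mu>24 mult_right_mono[of 1 \<kappa> \<mu>] mult_right_mono[of \<kappa> "12/7" \<mu>] by auto
  have kk: "\<kappa> \<le> \<kappa> * \<kappa>" "\<kappa> * \<kappa> \<le> 12 / 7 * \<kappa>"
    using \<kappa> mult_right_mono[of 1 \<kappa> \<kappa>] mult_right_mono[of \<kappa> "12/7" \<kappa>] by auto
  \<comment> \<open>Weighted Moore bound: the sets \<open>N j - {i}\<close> for
    \<open>j \<in> N i\<close> are pairwise disjoint by \<open>c4\<close> and miss
    \<open>N i\<close> by \<open>tri\<close>, so together they weigh at most n - c i - D i.\<close>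
  have moore: "(\<Sum>j\<in>N i. D j) \<le> real (card (N i)) * c i + (n - c i - D i)" if i: "i \<in> I" for i
  proof -
    have disj: "(N j - {i}) \<inter> (N k - {i}) = {}" if "j \<in> N i" "k \<in> N i" "j \<noteq> k" for j k
    proof -
      have "x = i" if "x \<in> N j" "x \<in> N k" for x
        using that \<open>j \<in> N i\<close> \<open>k \<in> N i\<close> \<open>j \<noteq> k\<close> c4[of i x j k] i unfolding N_def by blast
      then show ?thesis by blast
    qed
    have "(\<Sum>j\<in>N i. D j) = (\<Sum>j\<in>N i. c i + sum c (N j - {i}))"
    proof (intro sum.cong refl)
      fix j assume "j \<in> N i"
      then have "i \<in> N j" using symH i unfolding N_def by blast
      then show "D j = c i + sum c (N j - {i})"
        unfolding D_def using finN by (simp add: sum.remove)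
    qed
    also have "\<dots> = real (card (N i)) * c i + sum c (\<Union>j\<in>N i. N j - {i})"
      using disj finN by (subst sum.UNION_disjoint) (auto simp: sum.distrib)
    also have "sum c (\<Union>j\<in>N i. N j - {i}) \<le> sum c (I - insert i (N i))"
      using tri[of i] i NI by (intro sub_le) (auto simp: N_def)
    also have "sum c (I - insert i (N i)) = n - c i - D i"
      using irr[OF i] i I finN[of i] NI[of i]
      by (subst sum_diff) (auto simp: n D_def N_def)
    finally show ?thesis by simp
  qed
  \<comment> \<open>If \<open>c i \<le> \<mu> - \<kappa>\<close> and \<open>i\<close> has at least
    two neighbours, inserting the degree condition for \<open>i\<close> and its neighbours into
    \<open>moore\<close> yields \<open>\<mu> \<le> 6 + 5 * \<kappa>\<close>, which is below
    24.\<close>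
  have dicho: "card (N i) = 1 \<or> \<mu> - \<kappa> < c i" if i: "i \<in> I" for i
  proof (rule ccontr)
    assume "\<not> ?thesis"
    then have no: "card (N i) \<noteq> 1" "c i \<le> \<mu> - \<kappa>" by auto
    have "card (N i) \<noteq> 0"
    proof
      assume "card (N i) = 0"
      then have "D i = 0" using finN by (simp add: D_def)
      then show False using D[OF i] kc[OF i] \<mu>24 by simp
    qed
    then have r2: "2 \<le> real (card (N i))" using no by linarith
    have "real (card (N i)) * (\<mu> - \<kappa>) + \<kappa> * D i = (\<Sum>j\<in>N i. \<mu> + \<kappa> * (c j - 1))"
      unfolding D_def by (simp add: sum.distrib sum_subtractf sum_distrib_left algebra_simps)
    also have "\<dots> \<le> (\<Sum>j\<in>N i. D j)" using D NI by (intro sum_mono) auto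
    finally have "real (card (N i)) * (\<mu> - \<kappa> - c i) \<le> n - c i - D i - \<kappa> * D i"
      using moore[OF i] by (simp add: algebra_simps)
    moreover have "2 * (\<mu> - \<kappa> - c i) \<le> real (card (N i)) * (\<mu> - \<kappa> - c i)"
      using r2 no by (intro mult_right_mono) auto
    moreover have "\<kappa> * (\<mu> + \<kappa> * (c i - 1)) \<le> \<kappa> * D i" using D[OF i] \<kappa> by (intro mult_left_mono) auto
    ultimately have "2 * (\<mu> - \<kappa> - c i) \<le> n - c i - \<mu> - \<kappa> * (c i - 1) - \<kappa> * (\<mu> + \<kappa> * (c i - 1))"
      using D[OF i] by linarith
    then have "3 * \<mu> + \<kappa> * \<mu> + \<kappa> * (c i - 1) + \<kappa> * \<kappa> * (c i - 1) - (c i - 1) \<le> n + 2 * \<kappa> + 1"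
      by (simp add: algebra_simps)
    moreover have "c i - 1 \<le> \<kappa> * (c i - 1)" using \<kappa> c1[OF i] mult_right_mono[of 1 \<kappa> "c i - 1"] by simp
    moreover have "0 \<le> \<kappa> * \<kappa> * (c i - 1)" using \<kappa> c1[OF i] by simp
    ultimately have "3 * \<mu> + \<kappa> * \<mu> \<le> n + 2 * \<kappa> + 1" by linarith
    then have "\<mu> \<le> 6 + 5 * \<kappa>" using n\<mu> \<kappa> by linarith
    then show False using \<mu>24 \<kappa> by linarith
  qed
  have leaf: "\<exists>j\<in>N i. \<mu> \<le> c j" if i: "i \<in> I" "card (N i) = 1" for i
  proof -
    obtain j where "N i = {j}" using i card_1_singletonE by blast
    then show ?thesis using D[OF i(1)] kc[OF i(1)] by (auto simp: D_def)
  qed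
  obtain j where j: "j \<in> I" "\<mu> - \<kappa> < c j"
  proof -
    obtain i where i: "i \<in> I" using I by blast
    show ?thesis
    proof (cases "\<mu> - \<kappa> < c i")
      case False
      then obtain k where "k \<in> N i" "\<mu> \<le> c k" using leaf[OF i] dicho[OF i] by blast
      then show ?thesis using that[of k] NI \<kappa> by force
    qed (use i that in blast)
  qed
  have Dj: "D j > \<mu> + \<kappa> * \<mu> - \<kappa> * \<kappa> - \<kappa>"
  proof -
    have "\<kappa> * (\<mu> - \<kappa> - 1) < \<kappa> * (c j - 1)" using j \<kappa> by (intro mult_strict_left_mono) auto
    then show ?thesis using D[OF j(1)] by (simp add: algebra_simps)
  qed
  have restw: "sum c (I - insert j (N j)) = n - c j - D j"
    using irr[OF j(1)] j I finN[of j] NI[of j]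
    by (subst sum_diff) (auto simp: n D_def N_def)
  \<comment> \<open>The remaining weight is below 5 + 9/2 \<kappa> + \<kappa>^2 < 16. The round
    value 20 still lies below \<mu> - \<kappa>, so that a class outside is forced to be a
    leaf.\<close>
  have rest: "sum c (I - insert j (N j)) < 20"
  proof -
    have "n - c j - D j < 5 + 5 / 2 * \<kappa> + 2 * \<kappa> + \<kappa> * \<kappa>" using Dj j n\<mu> by linarith
    then show ?thesis using restw kk \<kappa> by linarith
  qed
  have out: "c k < 20" if "k \<in> I - insert j (N j)" for k
    using sub_le[of "{k}" "I - insert j (N j)"] that rest by auto
  have "I - insert j (N j) = {}"
  proof (rule ccontr)
    assume "\<not> ?thesis"
    then obtain k where k: "k \<in> I - insert j (N j)" by blast
    then have "card (N k) = 1" using dicho[of k] out[OF k] \<mu>24 \<kappa> by force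
    then obtain l where l: "l \<in> N k" "\<mu> \<le> c l" using leaf[of k] k by blast
    have lI: "l \<in> I" using l NI by blast
    have "l \<noteq> j" using l k symH[of k l] unfolding N_def by blast
    moreover have "l \<notin> I - insert j (N j)" using out[of l] l \<mu>24 by force
    ultimately have lj: "l \<in> N j" using lI by blast
    then have "N l \<inter> N j = {}" using tri[of j l] j lI by (auto simp: N_def)
    then have "D l + D j = sum c (N l \<union> N j)" unfolding D_def using finN by (simp add: sum.union_disjoint)
    also have "\<dots> \<le> n" unfolding n using NI by (intro sub_le) auto
    finally have "D l + D j \<le> n" .
    moreover have "D l \<ge> \<mu> + \<kappa> * \<mu> - \<kappa>"
    proof -
      have "\<kappa> * (\<mu> - 1) \<le> \<kappa> * (c l - 1)" using l \<kappa> by (intro mult_left_mono) auto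
      then show ?thesis using D[OF lI] by (simp add: algebra_simps)
    qed
    ultimately have "\<kappa> * \<mu> \<le> 5 + 5 / 2 * \<kappa> + 2 * \<kappa> + \<kappa> * \<kappa>"
      using Dj n\<mu> by linarith
    then show False using k\<mu> kk \<kappa> by linarith
  qed
  then have "I = insert j (N j)" using NI j by auto
  then show ?thesis using j by blast
qed

text \<open>Natural weights of total \<open>card V\<close> are finite in number once
  \<open>restrict\<close> removes the values off \<open>V\<close>, so a maximum exists. Least
  support among the maximisers is what later excludes light edges.\<close>

lemma optimal_weights:
  fixes B :: "'a \<Rightarrow> 'a \<Rightarrow> real"
  assumes V: "finite V"
  shows "\<exists>c :: 'a \<Rightarrow> nat. sum c V = card V \<and>
    quad_form B V (\<lambda>_. 1) \<le> quad_form B V (\<lambda>x. real (c x)) \<and>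
    (\<forall>c' :: 'a \<Rightarrow> nat. sum c' V = card V \<longrightarrow>
      quad_form B V (\<lambda>x. real (c' x)) \<le> quad_form B V (\<lambda>x. real (c x))) \<and>
    (\<forall>c' :: 'a \<Rightarrow> nat. sum c' V = card V \<longrightarrow>
      quad_form B V (\<lambda>x. real (c' x)) = quad_form B V (\<lambda>x. real (c x)) \<longrightarrow>
      card {x \<in> V. 0 < c x} \<le> card {x \<in> V. 0 < c' x})"
proof -
  let ?Q = "\<lambda>c :: 'a \<Rightarrow> nat. quad_form B V (\<lambda>x. real (c x))"
  define W where "W = {c \<in> V \<rightarrow>\<^sub>E {..card V}. sum c V = card V}"
  have finW: "finite W" unfolding W_def using V by (auto intro!: finite_PiE)
  have inW: "restrict c V \<in> W" if "sum c V = card V" for c :: "'a \<Rightarrow> nat"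
    unfolding W_def using that V member_le_sum[of _ V c] by auto
  have Qr: "?Q (restrict c V) = ?Q c" for c
    unfolding quad_form_def by (intro sum.cong) auto
  have le: "?Q c \<le> Max (?Q ` W)" if "sum c V = card V" for c
  proof -
    have "?Q (restrict c V) \<le> Max (?Q ` W)"
      using finW inW[OF that] by (intro Max_ge finite_imageI imageI)
    then show ?thesis unfolding Qr .
  qed
  have one: "sum (\<lambda>_. 1 :: nat) V = card V" by simp
  have "W \<noteq> {}" using inW[OF one] by blast
  then have "Max (?Q ` W) \<in> ?Q ` W" using finW by (intro Max_in) auto
  then obtain c0 where c0: "sum c0 V = card V \<and> ?Q c0 = Max (?Q ` W)" unfolding W_def by auto
  obtain c where c: "sum c V = card V \<and> ?Q c = Max (?Q ` W)"
    and least: "\<And>c'. sum c' V = card V \<and> ?Q c' = Max (?Q ` W) \<Longrightarrow>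
      card {x \<in> V. 0 < c x} \<le> card {x \<in> V. 0 < c' x}"
    using ex_has_least_nat[of "\<lambda>c. sum c V = card V \<and> ?Q c = Max (?Q ` W)" c0
        "\<lambda>c. card {x \<in> V. 0 < c x}"] c0 by blast
  have "quad_form B V (\<lambda>_. 1) \<le> ?Q c" using le[OF one] c by simp
  then show ?thesis using c le least by (intro exI[of _ c] conjI allI impI) auto
qed

text \<open>The constant weight 1 describes the graph itself, so an optimal blow-up needs to be
  bounded. If it beat \<open>opt_gain\<close>, its degrees would be large enough for
  \<open>star_structure\<close>, and a star does no better than the extremal construction.\<close>

lemma clean_gain_le_opt:
  fixes H L :: "'a \<Rightarrow> 'a \<Rightarrow> bool" and \<kappa> :: real
  assumes V: "finite V" "card V = n" "100 \<le> n" and \<kappa>: "1 \<le> \<kappa>" "\<kappa> \<le> 12 / 7"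
    and symH: "\<And>x y. H x y \<Longrightarrow> H y x" and symL: "\<And>x y. L x y \<Longrightarrow> L y x"
    and irrH: "\<And>x. \<not> H x x" and irrL: "\<And>x. \<not> L x x"
    and HL: "\<And>x y. H x y \<Longrightarrow> \<not> L x y"
    and tri: "\<And>x y z. x \<in> V \<Longrightarrow> y \<in> V \<Longrightarrow> z \<in> V \<Longrightarrow> H x y \<Longrightarrow> H y z \<Longrightarrow> \<not> H x z"
    and c4: "\<And>x y z t. x \<in> V \<Longrightarrow> y \<in> V \<Longrightarrow> z \<in> V \<Longrightarrow> t \<in> V \<Longrightarrow>
       x \<noteq> y \<Longrightarrow> z \<noteq> t \<Longrightarrow> H x z \<Longrightarrow> H z y \<Longrightarrow> H x t \<Longrightarrow> H t y \<Longrightarrow> L x y \<or> L z t"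
  shows "(\<Sum>x\<in>V. \<Sum>y\<in>V. of_bool (H x y) - \<kappa> * of_bool (L x y)) \<le> 2 * opt_gain \<kappa> n"
proof -
  \<comment> \<open>The diagonal -\<kappa> makes copies of one vertex light to each other. Since
    -\<kappa> c^2 = -\<kappa> c (c - 1) - \<kappa> c, twice the gain of the blow-up is
    \<open>?Q c + \<kappa> * n\<close>.\<close>
  define B where "B = (\<lambda>x y. of_bool (H x y) - \<kappa> * of_bool (L x y) - \<kappa> * of_bool (x = y))"
  let ?Q = "\<lambda>c :: 'a \<Rightarrow> nat. quad_form B V (\<lambda>x. real (c x))"
  have symB: "B p q = B q p" for p q
  proof -
    have "H p q = H q p" "L p q = L q p" using symH symL by blast+
    then show ?thesis by (simp add: B_def eq_commute)
  qed
  have Bd: "B x x = - \<kappa>" for x using irrH irrL by (simp add: B_def)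
  obtain c :: "'a \<Rightarrow> nat" where c: "sum c V = n" and start: "quad_form B V (\<lambda>_. 1) \<le> ?Q c"
    and opt': "\<forall>c'. sum c' V = n \<longrightarrow> ?Q c' \<le> ?Q c"
    and least': "\<forall>c'. sum c' V = n \<longrightarrow> ?Q c' = ?Q c \<longrightarrow>
      card {x \<in> V. 0 < c x} \<le> card {x \<in> V. 0 < c' x}"
    using optimal_weights[OF V(1), of B, unfolded V(2)] by (elim exE conjE)
  note opt = opt'[rule_format] and least = least'[rule_format]
  define I where "I = {x \<in> V. 0 < c x}"
  have I: "finite I" "I \<subseteq> V" using V by (auto simp: I_def)
  define g where "g = (\<lambda>z. \<Sum>k\<in>V. real (c k) * B z k)"
  have shift: "?Q (c(x := c x - t, y := c y + t)) = ?Q c + 2 * real t * (g y - g x)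
      + real t * real t * (2 * (- \<kappa> - B x y))"
    and shift_sum: "sum (c(x := c x - t, y := c y + t)) V = n"
    if "x \<in> V" "y \<in> V" "x \<noteq> y" "t \<le> c x" for x y t
  proof -
    have eq: "(\<lambda>z. real ((c(x := c x - t, y := c y + t)) z))
        = (\<lambda>z. real (c z))(x := real (c x) - real t, y := real (c y) + real t)"
      using that by auto
    show "?Q (c(x := c x - t, y := c y + t)) = ?Q c + 2 * real t * (g y - g x)
      + real t * real t * (2 * (- \<kappa> - B x y))"
      unfolding eq g_def using quad_form_shift[where B = B, OF V(1) that(1-3) symB, where c = "\<lambda>z. real (c z)" and t = "real t"] Bd
      by (simp add: algebra_simps del: fun_upd_apply)
    have "V = insert x (insert y (V - {x, y}))" "finite (V - {x, y})" using that V by auto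
    then have "sum f V = f x + f y + sum f (V - {x, y})" for f :: "'a \<Rightarrow> nat"
      using that by (metis (no_types, lifting) DiffD2 add.assoc insertCI insertE finite_insert sum.insert)
    moreover have "sum (c(x := c x - t, y := c y + t)) (V - {x, y}) = sum c (V - {x, y})"
      by (intro sum.cong) auto
    ultimately show "sum (c(x := c x - t, y := c y + t)) V = n"
      using that c by simp
  qed
  have noL: "\<not> L x y" if xy: "x \<in> I" "y \<in> I" for x y
  proof
    assume L: "L x y"
    text \<open>\<open>?Q\<close> is affine along the edge \<open>xy\<close>, so that all weight can be moved to one end.\<close>
    have *: False if "p \<in> I" "q \<in> I" "L p q" "g p \<le> g q" for p q
    proof -
      have pq: "p \<in> V" "q \<in> V" "p \<noteq> q" using that I irrL by auto
      let ?c = "c(p := c p - c p, q := c q + c p)"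
      have "B p q = - \<kappa>" using that HL pq by (auto simp: B_def)
      then have "?Q ?c = ?Q c + 2 * real (c p) * (g q - g p)" using shift[OF pq, of "c p"] by simp
      moreover have "0 \<le> 2 * real (c p) * (g q - g p)" using that by simp
      ultimately have "?Q ?c = ?Q c" using opt[OF shift_sum[OF pq order_refl]] by linarith
      then have "card I \<le> card {x \<in> V. 0 < ?c x}"
        using least[OF shift_sum[OF pq order_refl]] by (simp add: I_def)
      also have "\<dots> \<le> card (I - {p})" using that pq I V by (intro card_mono) (auto simp: I_def)
      also have "\<dots> < card I" using that I by (intro psubset_card_mono) auto
      finally show False by simp
    qed
    show False using *[OF xy L] *[OF xy(2,1) symL[OF L]] by linarith
  qed
  define N where "N = (\<lambda>x. {y \<in> I. H x y})"
  have sumI: "(\<Sum>k\<in>V. real (c k) * f k) = (\<Sum>k\<in>I. real (c k) * f k)" for f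
    using V I by (intro sum.mono_neutral_right) (auto simp: I_def)
  have gI: "g x = (\<Sum>k\<in>N x. real (c k)) - \<kappa> * real (c x)" if "x \<in> I" for x
  proof -
    have "g x = (\<Sum>k\<in>I. (if H x k then real (c k) else 0) - (if k = x then \<kappa> * real (c k) else 0))"
      unfolding g_def sumI using noL[OF that] irrH by (intro sum.cong) (auto simp: B_def)
    also have "\<dots> = (\<Sum>k\<in>N x. real (c k)) - \<kappa> * real (c x)"
      using I that unfolding N_def sum_subtractf by (subst sum.inter_filter) auto
    finally show ?thesis .
  qed
  have nI: "real n = (\<Sum>k\<in>I. real (c k))" using sumI[of "\<lambda>_. 1"] c by (simp flip: of_nat_sum)
  have Qg: "?Q c = (\<Sum>x\<in>I. real (c x) * g x)"
    unfolding quad_form_def g_def sumI[symmetric] by (simp add: sum_distrib_left algebra_simps)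
  have "(?Q c + \<kappa> * n) / 2 \<le> opt_gain \<kappa> n"
  proof (rule ccontr)
    assume "\<not> ?thesis"
    then have big: "?Q c > 2 * opt_gain \<kappa> n - \<kappa> * n" by simp
    \<comment> \<open>Discrete first-order condition: moving a single copy from \<open>x\<close> to
      \<open>y\<close> cannot raise \<open>?Q\<close>.\<close>
    have step: "real (c y) * g y \<le> real (c y) * (g x + \<kappa>) + (if H x y then real (c y) else 0)"
      if xy: "x \<in> I" "y \<in> I" for x y
    proof -
      have "g y - of_bool (H x y) \<le> g x + \<kappa>"
      proof (cases "x = y")
        case True
        then show ?thesis using \<kappa> by simp
      next
        case False
        have x: "x \<in> V" "y \<in> V" "1 \<le> c x" using xy by (auto simp: I_def)
        have "B x y = of_bool (H x y)" using False noL xy by (auto simp: B_def)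
        then show ?thesis
          using shift[OF x(1,2) False x(3)] opt[OF shift_sum[OF x(1,2) False x(3)]] by simp
      qed
      then have "real (c y) * (g y - of_bool (H x y)) \<le> real (c y) * (g x + \<kappa>)"
        by (intro mult_left_mono) auto
      then show ?thesis by (auto simp: algebra_simps)
    qed
    \<comment> \<open>The loss 5/2 covers \<kappa> + 1 + 1/n - \<kappa>/(2 + \<kappa>), the error
      that arises when \<open>step\<close> is summed over all copies \<open>y\<close> and the result
      is compared with \<open>opt_gain_lower\<close>.\<close>
    define \<mu> where "\<mu> = real n / (2 + \<kappa>) - 5 / 2"
    have deg: "\<mu> + \<kappa> * (real (c x) - 1) \<le> (\<Sum>k\<in>N x. real (c k))" if x: "x \<in> I" for x
    proof -
      have "?Q c \<le> (\<Sum>y\<in>I. real (c y) * (g x + \<kappa>) + (if H x y then real (c y) else 0))"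
        unfolding Qg using step[OF x] by (rule sum_mono)
      also have "\<dots> = real n * (g x + \<kappa>) + (\<Sum>y\<in>N x. real (c y))"
        unfolding nI sum.distrib sum_distrib_right[symmetric] N_def using I by (simp add: sum.inter_filter)
      also have "(\<Sum>y\<in>N x. real (c y)) \<le> real n"
        unfolding nI using I by (intro sum_mono2) (auto simp: N_def)
      finally have "?Q c \<le> real n * (g x + \<kappa> + 1)" by (simp add: algebra_simps)
      moreover have "2 * opt_gain \<kappa> n \<ge> real n * (\<mu> + \<kappa> + 1)"
      proof -
        have "2 * opt_gain \<kappa> n \<ge> (real n * real n + \<kappa> * real n) / (2 + \<kappa>) - 1"
          using opt_gain_lower[of \<kappa> n] \<kappa> V by (simp add: field_simps)
        moreover have "(real n * real n + \<kappa> * real n) / (2 + \<kappa>)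
            = real n * \<mu> + 5 / 2 * real n + \<kappa> / (2 + \<kappa>) * real n"
          unfolding \<mu>_def by (simp add: add_divide_distrib right_diff_distrib)
        moreover have "1 / 3 * real n \<le> \<kappa> / (2 + \<kappa>) * real n"
          using \<kappa> by (intro mult_right_mono) (auto simp: field_simps)
        moreover have "\<kappa> * real n \<le> 12 / 7 * real n" using \<kappa> by (intro mult_right_mono) auto
        ultimately have "2 * opt_gain \<kappa> n \<ge> real n * \<mu> + \<kappa> * real n + real n"
          using V(3) by linarith
        then show ?thesis by (simp add: algebra_simps)
      qed
      ultimately have "real n * (\<mu> + \<kappa> + 1) - \<kappa> * real n < real n * (g x + \<kappa> + 1)"
        using big by linarith
      then have "real n * \<mu> < real n * (g x + \<kappa>)" by (simp add: algebra_simps)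
      then have "\<mu> < g x + \<kappa>" using V(3) by simp
      then show ?thesis using gI[OF x] by (simp add: algebra_simps)
    qed
    have ne: "I \<noteq> {}" using nI V(3) by auto
    have "\<exists>j\<in>I. I = insert j (N j)"
      unfolding N_def
    proof (rule star_structure[where c = "\<lambda>x. real (c x)" and n = "real n" and \<kappa> = \<kappa> and \<mu> = \<mu>])
      fix x y z t assume "x \<in> I" "y \<in> I" "z \<in> I" "t \<in> I" "x \<noteq> y" "H x z" "H z y" "H x t" "H t y"
      then show "z = t" using c4[of x y z t] noL I by blast
    next
      fix x y z assume "x \<in> I" "y \<in> I" "z \<in> I" "H x y" "H y z"
      then show "\<not> H x z" using tri[of x y z] I by blast
    next
      fix x y assume "H x y"
      then show "H y x" by (rule symH)
    next
      fix x assume "x \<in> I"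
      then show "\<mu> + \<kappa> * (real (c x) - 1) \<le> (\<Sum>y\<in>{y \<in> I. H x y}. real (c y))"
        using deg by (simp add: N_def)
    next
      fix x assume "x \<in> I"
      then show "1 \<le> real (c x)" by (simp add: I_def)
    qed (use V(3) \<kappa>(2) in \<open>simp_all add: I(1) ne irrH \<kappa>(1) \<mu>_def flip: nI\<close>)
    then obtain j where j: "j \<in> I" "I = insert j (N j)" by (elim bexE)
    have jN: "j \<notin> N j" using irrH by (simp add: N_def)
    have finN: "finite (N j)" using I by (simp add: N_def)
    have Nj: "(\<Sum>k\<in>N j. real (c k)) = real n - real (c j)"
      using nI j jN finN by (metis add_diff_cancel_left' sum.insert)
    \<comment> \<open>The centre \<open>j\<close> plays \<open>V\<^sub>0\<close> and the leaves play
      the other part. Using only c l \<ge> 1 amounts to splitting each leaf class into single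
      vertices joined by pairs of multiplicity \<open>a\<close>, which can only raise the
      gain.\<close>
    have gl: "real (c l) * g l \<le> real (c l) * (real (c j) - \<kappa>)" if l: "l \<in> N j" for l
    proof -
      have lI: "l \<in> I" using l by (simp add: N_def)
      have "N l = {j}"
      proof
        show "{j} \<subseteq> N l" using l j(1) symH[of j l] by (simp add: N_def)
        show "N l \<subseteq> {j}"
        proof
          fix k assume k: "k \<in> N l"
          then have "\<not> H j k" using tri[of j l k] l j(1) I(2) lI unfolding N_def by blast
          moreover have "k \<in> insert j (N j)" using k j(2) unfolding N_def by blast
          ultimately show "k \<in> {j}" unfolding N_def by blast
        qed
      qed
      then have "g l = real (c j) - \<kappa> * real (c l)" using gI[OF lI] by simp
      moreover have "\<kappa> * 1 \<le> \<kappa> * real (c l)" using lI \<kappa> by (intro mult_left_mono) (auto simp: I_def)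
      ultimately show ?thesis by (intro mult_left_mono) auto
    qed
    have "?Q c = (\<Sum>l\<in>insert j (N j). real (c l) * g l)"
      unfolding Qg by (rule arg_cong[OF j(2)])
    also have "\<dots> = real (c j) * g j + (\<Sum>l\<in>N j. real (c l) * g l)"
      by (rule sum.insert[OF finN jN])
    also have "\<dots> \<le> real (c j) * g j + (\<Sum>l\<in>N j. real (c l) * (real (c j) - \<kappa>))"
      using gl by (intro add_left_mono sum_mono)
    also have "\<dots> = real (c j) * (real n - real (c j) - \<kappa> * real (c j)) + (real n - real (c j)) * (real (c j) - \<kappa>)"
      unfolding sum_distrib_right[symmetric] Nj gI[OF j(1)] by simp
    also have "\<dots> = 2 * split_gain \<kappa> n (c j) - \<kappa> * real n"
      unfolding split_gain_def by (simp add: field_simps)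
    also have "\<dots> \<le> 2 * opt_gain \<kappa> n - \<kappa> * real n"
      using split_gain_le_opt[of "c j" n \<kappa>] member_le_sum[of j V c] j(1) I V c by auto
    finally show False using big by simp
  qed
  moreover have "quad_form B V (\<lambda>_. 1)
      = (\<Sum>x\<in>V. \<Sum>y\<in>V. of_bool (H x y) - \<kappa> * of_bool (L x y)) - \<kappa> * real n"
  proof -
    have "(\<Sum>y\<in>V. B x y) = (\<Sum>y\<in>V. of_bool (H x y) - \<kappa> * of_bool (L x y)) - \<kappa>" if "x \<in> V" for x
    proof -
      have "(\<Sum>y\<in>V. \<kappa> * of_bool (x = y)) = \<kappa>"
        unfolding sum_distrib_left[symmetric] using that V by (simp add: of_bool_def)
      then show ?thesis unfolding B_def sum_subtractf by simp
    qed
    then show ?thesis unfolding quad_form_def using V by (simp add: sum_subtractf)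
  qed
  ultimately show ?thesis using start by simp
qed

section \<open>Removal of heavy sets\<close>

text \<open>Quadratic in m, so that deleting k vertices raises it by a linear amount only. The
  coefficient 3/500 is small enough for the margin in \<open>opt_gain_step\<close>, and with zero at
  503 the values below 100 are large enough to absorb the averaging estimate there.\<close>

definition slack :: "nat \<Rightarrow> real" where
  "slack m = max 0 (3 / 500 * (503 ^ 2 - real m ^ 2))"

text \<open>In the application \<open>h w = (ln w - ln a) / ln ((a + 1) / a)\<close>; the proof of the upper bound
  only needs the following bounds on it.\<close>

definition gain_function :: "nat \<Rightarrow> real \<Rightarrow> (nat \<Rightarrow> real) \<Rightarrow> bool" where
  "gain_function a \<kappa> h \<longleftrightarrow> 1 \<le> \<kappa> \<and> \<kappa> \<le> 12 / 7 \<and>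
    (\<forall>w\<ge>1. h w \<le> real w - real a) \<and> (\<forall>w\<ge>1. w < a \<longrightarrow> h w \<le> - \<kappa>)"

lemma gain_functionD:
  assumes "gain_function a \<kappa> h"
  shows "1 \<le> \<kappa>" "\<kappa> \<le> 12 / 7" "1 \<le> w \<Longrightarrow> h w \<le> real w - real a"
    "1 \<le> w \<Longrightarrow> w < a \<Longrightarrow> h w \<le> - \<kappa>"
  using assms by (auto simp: gain_function_def)

lemma sum_gain_le:
  assumes gf: "gain_function a \<kappa> h"
    and "finite X" "\<And>e. e \<in> nsets X 2 \<Longrightarrow> 1 \<le> w e"
  shows "(\<Sum>e\<in>nsets X 2. h (w e))
    \<le> real (\<Sum>e\<in>nsets X 2. w e) - real (card X * (card X - 1) div 2) * real a"
proof -
  have "(\<Sum>e\<in>nsets X 2. h (w e)) \<le> (\<Sum>e\<in>nsets X 2. real (w e) - real a)"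
    using assms gain_functionD(3)[OF gf] by (intro sum_mono) auto
  also have "\<dots> = real (\<Sum>e\<in>nsets X 2. w e) - real (card (nsets X 2)) * real a"
    by (simp add: sum_subtractf)
  finally show ?thesis by (simp add: card_nsets choose_two)
qed

text \<open>The edge sum of \<open>X\<close> plus any outside vertex is bounded, so the excess of
  \<open>X\<close> over its constant-\<open>a\<close> value is paid back by every outside vertex:
  each sends gain at most t' minus that excess.\<close>

lemma gain_remove_heavy_set:
  fixes t t' :: nat
  assumes gf: "gain_function a \<kappa> h"
    and V: "finite V" and X: "X \<subseteq> V" "card X < card V"
    and pos: "\<And>e. e \<in> nsets V 2 \<Longrightarrow> 1 \<le> w e"
    and heavy: "card X * (card X - 1) div 2 * a + t \<le> (\<Sum>e\<in>nsets X 2. w e)"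
    and ext: "\<And>y. y \<in> V - X \<Longrightarrow>
      (\<Sum>e\<in>nsets (insert y X) 2. w e) \<le> (card X * (card X - 1) div 2 + card X) * a + t'"
  shows "(\<Sum>e\<in>nsets V 2. h (w e)) \<le> (\<Sum>e\<in>nsets (V - X) 2. h (w e))
    + real t + (real (card V) - real (card X)) * (real t' - real t)"
proof -
  define k where "k = card X"
  define b where "b = real (k * (k - 1) div 2) * real a"
  define s where "s = real (\<Sum>e\<in>nsets X 2. w e)"
  have finX: "finite X" using V X finite_subset by blast
  have heavy': "b + real t \<le> s"
    using heavy unfolding b_def s_def k_def by (metis of_nat_add of_nat_le_iff of_nat_mult)
  have inner: "(\<Sum>e\<in>nsets X 2. h (w e)) \<le> s - b"
    unfolding s_def b_def k_def using X pos finX by (intro sum_gain_le[OF gf]) (auto simp: nsets_def)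
  have outer: "(\<Sum>x\<in>X. h (w {x, y})) \<le> b + real t' - s" if y: "y \<in> V - X" for y
  proof -
    have "1 \<le> w {x, y}" if "x \<in> X" for x
      using that y X by (intro pos) (auto simp: nsets_def card_insert_if)
    then have "(\<Sum>x\<in>X. h (w {x, y})) \<le> (\<Sum>x\<in>X. real (w {x, y}) - real a)"
      by (intro sum_mono gain_functionD(3)[OF gf])
    also have "\<dots> = real (\<Sum>x\<in>X. w {y, x}) - real k * real a"
      by (simp add: sum_subtractf k_def insert_commute)
    also have "real (\<Sum>x\<in>X. w {y, x}) = real (\<Sum>e\<in>nsets (insert y X) 2. w e) - s"
      using sum_nsets_insert[of X y w] y finX by (simp add: s_def)
    also have "real (\<Sum>e\<in>nsets (insert y X) 2. w e) \<le> b + real k * real a + real t'"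
    proof -
      have "real (\<Sum>e\<in>nsets (insert y X) 2. w e) \<le> real ((k * (k - 1) div 2 + k) * a + t')"
        using ext[OF y] unfolding k_def of_nat_le_iff .
      then show ?thesis unfolding b_def by (simp add: algebra_simps)
    qed
    finally show ?thesis by simp
  qed
  have "(\<Sum>x\<in>X. \<Sum>y\<in>V - X. h (w {x, y})) = (\<Sum>y\<in>V - X. \<Sum>x\<in>X. h (w {x, y}))"
    by (rule sum.swap)
  also have "\<dots> \<le> real (card (V - X)) * (b + real t' - s)"
    using outer by (intro sum_bounded_above) auto
  also have "real (card (V - X)) = real (card V) - real k"
    using X V finX by (simp add: card_Diff_subset k_def card_mono of_nat_diff)
  finally have cross: "(\<Sum>x\<in>X. \<Sum>y\<in>V - X. h (w {x, y})) \<le> (real (card V) - real k) * (b + real t' - s)" .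
  have "X \<union> (V - X) = V" using X by blast
  then have "(\<Sum>e\<in>nsets V 2. h (w e)) = (\<Sum>e\<in>nsets X 2. h (w e)) + (\<Sum>e\<in>nsets (V - X) 2. h (w e))
      + (\<Sum>x\<in>X. \<Sum>y\<in>V - X. h (w {x, y}))"
    using sum_nsets_Un[of X "V - X" "\<lambda>e. h (w e)"] V finX by simp
  \<comment> \<open>Some vertex lies outside \<open>X\<close>, so excess beyond \<open>t\<close>
    costs at least as much across the cut as it adds inside. The worst case is therefore excess
    exactly \<open>t\<close>.\<close>
  moreover have "1 * (s - b - t) \<le> (real (card V) - real k) * (s - b - t)"
    using X heavy' by (intro mult_right_mono) (auto simp: k_def)
  ultimately show ?thesis using inner cross by (simp add: algebra_simps k_def)
qed

text \<open>The bound on 3-sets forbids triangles in \<open>H\<close>. In a 4-cycle of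
  \<open>H\<close> the sides use 4 (a + 1) of the allowed 6a + 3, leaving at most 2a - 1 for the two
  diagonals, so one of them is light.\<close>

lemma clean_multigraph_gain:
  assumes gf: "gain_function a \<kappa> h"
    and V: "finite V" "100 \<le> card V"
    and pos: "\<And>e. e \<in> nsets V 2 \<Longrightarrow> 1 \<le> w e"
    and two: "\<And>X. X \<subseteq> V \<Longrightarrow> card X = 2 \<Longrightarrow> (\<Sum>e\<in>nsets X 2. w e) \<le> a + 1"
    and three: "\<And>X. X \<subseteq> V \<Longrightarrow> card X = 3 \<Longrightarrow> (\<Sum>e\<in>nsets X 2. w e) \<le> 3 * a + 2"
    and four: "\<And>X. X \<subseteq> V \<Longrightarrow> card X = 4 \<Longrightarrow> (\<Sum>e\<in>nsets X 2. w e) \<le> 6 * a + 3"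
  shows "(\<Sum>e\<in>nsets V 2. h (w e)) \<le> opt_gain \<kappa> (card V)"
proof -
  have n1: "nsets {x} 2 = {}" for x :: 'a by (auto simp: nsets_def card_insert_if card_1_singleton_iff subset_singleton_iff)
  have e2: "(\<Sum>e\<in>nsets {x, y} 2. w e) = w {x, y}" if "x \<noteq> y" for x y
    using sum_nsets_insert[of "{y}" x w] n1 that by simp
  have e3: "(\<Sum>e\<in>nsets {x, y, z} 2. w e) = w {y, z} + w {x, y} + w {x, z}"
    if "x \<noteq> y" "x \<noteq> z" "y \<noteq> z" for x y z
    using sum_nsets_insert[of "{y, z}" x w] e2 that by simp
  have e4: "(\<Sum>e\<in>nsets {u, x, y, z} 2. w e) = w {y, z} + w {x, y} + w {x, z} + w {u, x} + w {u, y} + w {u, z}"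
    if "x \<noteq> y" "x \<noteq> z" "y \<noteq> z" "u \<noteq> x" "u \<noteq> y" "u \<noteq> z" for u x y z
    using sum_nsets_insert[of "{x, y, z}" u w] e3 that by simp
  define H where "H = (\<lambda>x y. x \<noteq> y \<and> w {x, y} = a + 1)"
  define L where "L = (\<lambda>x y. x \<noteq> y \<and> w {x, y} < a)"
  have le: "w {x, y} \<le> a + 1" if "x \<in> V" "y \<in> V" "x \<noteq> y" for x y
    using two[of "{x, y}"] e2 that by simp
  have h_bound: "h (w {x, y}) \<le> of_bool (H x y) - \<kappa> * of_bool (L x y)"
    if xy: "x \<in> V" "y \<in> V" "x \<noteq> y" for x y
  proof -
    have 1: "1 \<le> w {x, y}" using xy by (intro pos) (auto simp: nsets_def)
    consider "w {x, y} < a" | "w {x, y} = a" | "w {x, y} = a + 1" using le[OF xy] by linarith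
    then show ?thesis
      by cases (use that 1 gain_functionD(3,4)[OF gf 1] in \<open>auto simp: H_def L_def\<close>)
  qed
  have "2 * (\<Sum>e\<in>nsets V 2. h (w e)) = (\<Sum>x\<in>V. \<Sum>y\<in>V - {x}. h (w {x, y}))"
    using sum_nsets_handshake[OF V(1), of "\<lambda>e. h (w e)"] by simp
  also have "\<dots> \<le> (\<Sum>x\<in>V. \<Sum>y\<in>V - {x}. of_bool (H x y) - \<kappa> * of_bool (L x y))"
    by (intro sum_mono h_bound) auto
  also have "\<dots> = (\<Sum>x\<in>V. \<Sum>y\<in>V. of_bool (H x y) - \<kappa> * of_bool (L x y))"
    using V by (intro sum.cong sum.mono_neutral_left) (auto simp: H_def L_def)
  also have "\<dots> \<le> 2 * opt_gain \<kappa> (card V)"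
  proof (rule clean_gain_le_opt[OF V(1) refl V(2) gain_functionD(1,2)[OF gf]])
    fix x y z assume xyz: "x \<in> V" "y \<in> V" "z \<in> V" "H x y" "H y z"
    show "\<not> H x z"
    proof
      assume "H x z"
      then have d: "x \<noteq> y" "x \<noteq> z" "y \<noteq> z" using xyz by (auto simp: H_def)
      then have "(\<Sum>e\<in>nsets {x, y, z} 2. w e) = 3 * a + 3"
        using e3[OF d] xyz \<open>H x z\<close> by (simp add: H_def)
      moreover have "(\<Sum>e\<in>nsets {x, y, z} 2. w e) \<le> 3 * a + 2"
        using xyz d by (intro three) auto
      ultimately show False by simp
    qed
  next
    fix x y z t assume V': "x \<in> V" "y \<in> V" "z \<in> V" "t \<in> V"
      and d: "x \<noteq> y" "z \<noteq> t" and HH: "H x z" "H z y" "H x t" "H t y"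
    have d': "z \<noteq> t" "z \<noteq> y" "t \<noteq> y" "x \<noteq> z" "x \<noteq> t" "x \<noteq> y" using d HH by (auto simp: H_def)
    have "w {z, t} + w {z, y} + w {t, y} + w {x, z} + w {x, t} + w {x, y} \<le> 6 * a + 3"
      using four[of "{x, z, t, y}"] e4[OF d'] V' d' by simp
    then have "w {z, t} + w {x, y} < 2 * a" using HH by (simp add: H_def)
    then have "w {z, t} < a \<or> w {x, y} < a" by linarith
    then show "L x y \<or> L z t" using d by (auto simp: L_def)
  qed (auto simp: H_def L_def insert_commute)
  finally show ?thesis by simp
qed

text \<open>The slack absorbs the crude base case. Every removal of a heavy set strictly loses against
  the optimum, by more than the slack grows, so nothing of it is left from 503 vertices on.\<close>

lemma gain_le_opt_plus_slack:
  assumes gf: "gain_function a \<kappa> h"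
    and "finite V" "95 \<le> card V"
    and "\<And>e. e \<in> nsets V 2 \<Longrightarrow> 1 \<le> w e"
    and "\<And>X. X \<subseteq> V \<Longrightarrow> card X = 6 \<Longrightarrow> (\<Sum>e\<in>nsets X 2. w e) \<le> 15 * a + 7"
  shows "(\<Sum>e\<in>nsets V 2. h (w e)) \<le> opt_gain \<kappa> (card V) + slack (card V)"
  using assms(2-)
proof (induction "card V" arbitrary: V rule: less_induct)
  case less
  note \<kappa> = gain_functionD(1,2)[OF gf]
  note V = less.prems(1) and pos = less.prems(3) and six = less.prems(4)
  define m where "m = card V"
  show ?case
  proof (cases "m < 100")
    case True
    \<comment> \<open>Each 6-set has gain at most 7, and 30 = 6 * 5. Sizes 95 to 99 form the base
      because a deletion takes at most 5 vertices from at least 100.\<close>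
    have "(\<Sum>e\<in>nsets V 2. h (w e)) \<le> 7 / 30 * (real (card V) * (real (card V) - 1))"
    proof (rule sum_nsets_average[where s = 6])
      fix X assume X: "X \<subseteq> V" "card X = 6"
      have "(\<Sum>e\<in>nsets X 2. h (w e)) \<le> real (\<Sum>e\<in>nsets X 2. w e) - real (card X * (card X - 1) div 2) * real a"
        using X pos V finite_subset[of X V] by (intro sum_gain_le[OF gf]) (auto simp: nsets_def)
      moreover have "real (\<Sum>e\<in>nsets X 2. w e) \<le> real (15 * a + 7)"
        using six[OF X] unfolding of_nat_le_iff .
      ultimately show "(\<Sum>e\<in>nsets X 2. h (w e)) \<le> 7 / 30 * (real 6 * (real 6 - 1))"
        using X by simp
    qed (use V less.prems(2) in auto)
    moreover have "7 / 30 * (real m * (real m - 1)) \<le> opt_gain \<kappa> m + slack m"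
    proof -
      have "real m * real m \<le> 10000" using True mult_mono[of "real m" 100 "real m" 100] by simp
      moreover have "7 / 52 * (real m * real m) - 1 / 2 \<le> opt_gain \<kappa> m"
      proof -
        have "7 / 52 * (real m * real m) \<le> 1 / (2 * (2 + \<kappa>)) * (real m * real m)"
          using \<kappa> by (intro mult_right_mono) (auto simp: field_simps)
        also have "\<dots> \<le> 1 / (2 * (2 + \<kappa>)) * (real m * real m + \<kappa> * real m)"
          using \<kappa> by (intro mult_left_mono) auto
        also have "\<dots> = (real m * real m + \<kappa> * real m) / (2 * (2 + \<kappa>))" by simp
        also have "\<dots> \<le> opt_gain \<kappa> m + 1 / 2"
          using opt_gain_lower[of \<kappa> m] \<kappa> less.prems(2) by (simp add: m_def)
        finally show ?thesis by simp
      qed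
      moreover have "slack m \<ge> 1518 - 3 / 500 * (real m * real m)"
        by (simp add: slack_def power2_eq_square max_def algebra_simps)
      ultimately have "7 / 30 * (real m * real m) \<le> opt_gain \<kappa> m + slack m" by linarith
      moreover have "7 / 30 * (real m * (real m - 1)) \<le> 7 / 30 * (real m * real m)"
        by (intro mult_left_mono) auto
      ultimately show ?thesis by (rule order_trans[rotated])
    qed
    ultimately show ?thesis by (simp add: m_def)
  next
    case False
    \<comment> \<open>\<open>T\<close> bounds the whole gain lost with \<open>X\<close>:
      \<open>t\<close> inside and t' - t for each of the m - k remaining vertices.\<close>
    have heavy: "(\<Sum>e\<in>nsets V 2. h (w e)) \<le> opt_gain \<kappa> (card V) + slack (card V)"
      if X: "X \<subseteq> V" "card X = k" and k: "2 \<le> k" "k \<le> 5"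
        and hv: "k * (k - 1) div 2 * a + t \<le> (\<Sum>e\<in>nsets X 2. w e)"
        and ext: "\<And>Y. Y \<subseteq> V \<Longrightarrow> card Y = k + 1 \<Longrightarrow> (\<Sum>e\<in>nsets Y 2. w e) \<le> (k * (k - 1) div 2 + k) * a + t'"
        and kt: "(k = 5 \<and> T = m + 1) \<or> (k = 4 \<and> T = m) \<or> (k = 3 \<and> T = 3) \<or> (k = 2 \<and> T = 2)"
        and T: "real t + (real m - real k) * (real t' - real t) = real T"
      for X k t t' T
    proof -
      have finX: "finite X" using X V finite_subset by blast
      have card': "card (V - X) = m - k" using X finX V by (simp add: card_Diff_subset m_def)
      have "(\<Sum>e\<in>nsets V 2. h (w e)) \<le> (\<Sum>e\<in>nsets (V - X) 2. h (w e))
          + real t + (real (card V) - real (card X)) * (real t' - real t)"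
      proof (rule gain_remove_heavy_set[OF gf V X(1) _ pos])
        fix y assume y: "y \<in> V - X"
        show "(\<Sum>e\<in>nsets (insert y X) 2. w e) \<le> (card X * (card X - 1) div 2 + card X) * a + t'"
          unfolding X(2) using X y finX by (intro ext) auto
      qed (use X hv k False in \<open>auto simp: m_def\<close>)
      also have "\<dots> = (\<Sum>e\<in>nsets (V - X) 2. h (w e)) + real T"
        using T X by (simp add: m_def)
      also have "(\<Sum>e\<in>nsets (V - X) 2. h (w e)) \<le> opt_gain \<kappa> (m - k) + slack (m - k)"
        unfolding card'[symmetric]
      proof (rule less.hyps)
        show "card (V - X) < card V" using card' k False by (simp add: m_def)
        show "1 \<le> w e" if "e \<in> nsets (V - X) 2" for e
          using that by (intro pos) (auto simp: nsets_def)
      qed (use V six card' k False in auto)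
      also have "slack (m - k) \<le> slack m + 3 / 500 * (real m ^ 2 - real (m - k) ^ 2)"
      proof -
        have "real (m - k) ^ 2 \<le> real m ^ 2" by (intro power_mono) auto
        then have "0 \<le> slack m + 3 / 500 * (real m ^ 2 - real (m - k) ^ 2)"
          by (simp add: slack_def)
        moreover have "3 / 500 * (503 ^ 2 - real m ^ 2) \<le> slack m"
          unfolding slack_def by (rule max.cobounded2)
        then have "3 / 500 * (503 ^ 2 - real (m - k) ^ 2)
            \<le> slack m + 3 / 500 * (real m ^ 2 - real (m - k) ^ 2)"
          by (simp add: field_simps)
        ultimately show ?thesis unfolding slack_def[of "m - k"] by (rule max.boundedI)
      qed
      finally show ?thesis
        using opt_gain_step[OF \<kappa> _ kt] False by (simp add: m_def)
    qed
    show ?thesis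
    \<comment> \<open>Sizes are tried from 5 down to 2. The bound already known one size up, for
      size 5 the hypothesis on 6-sets, serves as \<open>ext\<close>, which gives (t, t') = (6, 7),
      (4, 5), (3, 3), (2, 2).\<close>
    proof (cases "\<exists>X \<subseteq> V. card X = 5 \<and> 10 * a + 6 \<le> (\<Sum>e\<in>nsets X 2. w e)")
      case True
      then obtain X where "X \<subseteq> V" "card X = 5" "10 * a + 6 \<le> (\<Sum>e\<in>nsets X 2. w e)" by blast
      then show ?thesis using six False by (intro heavy[of X 5 6 7 "m + 1"]) auto
    next
      case no5: False
      then have five: "(\<Sum>e\<in>nsets X 2. w e) \<le> 10 * a + 5" if "X \<subseteq> V" "card X = 5" for X
        using that by force
      show ?thesis
      proof (cases "\<exists>X \<subseteq> V. card X = 4 \<and> 6 * a + 4 \<le> (\<Sum>e\<in>nsets X 2. w e)")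
        case True
        then obtain X where "X \<subseteq> V" "card X = 4" "6 * a + 4 \<le> (\<Sum>e\<in>nsets X 2. w e)" by blast
        then show ?thesis using five False by (intro heavy[of X 4 4 5 m]) auto
      next
        case no4: False
        then have four: "(\<Sum>e\<in>nsets X 2. w e) \<le> 6 * a + 3" if "X \<subseteq> V" "card X = 4" for X
          using that by force
        show ?thesis
        proof (cases "\<exists>X \<subseteq> V. card X = 3 \<and> 3 * a + 3 \<le> (\<Sum>e\<in>nsets X 2. w e)")
          case True
          then obtain X where "X \<subseteq> V" "card X = 3" "3 * a + 3 \<le> (\<Sum>e\<in>nsets X 2. w e)" by blast
          then show ?thesis using four by (intro heavy[of X 3 3 3 3]) auto
        next
          case no3: False
          then have three: "(\<Sum>e\<in>nsets X 2. w e) \<le> 3 * a + 2" if "X \<subseteq> V" "card X = 3" for X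
            using that by force
          show ?thesis
          proof (cases "\<exists>X \<subseteq> V. card X = 2 \<and> a + 2 \<le> (\<Sum>e\<in>nsets X 2. w e)")
            case True
            then obtain X where "X \<subseteq> V" "card X = 2" "a + 2 \<le> (\<Sum>e\<in>nsets X 2. w e)" by blast
            moreover have "(\<Sum>e\<in>nsets Y 2. w e) \<le> (2 * (2 - 1) div 2 + 2) * a + 2"
              if "Y \<subseteq> V" "card Y = 2 + 1" for Y
              using three[of Y] that by simp
            ultimately show ?thesis by (intro heavy[of X 2 2 2 2]) auto
          next
            case no2: False
            then have two: "(\<Sum>e\<in>nsets X 2. w e) \<le> a + 1" if "X \<subseteq> V" "card X = 2" for X
              using that by force
            have "(\<Sum>e\<in>nsets V 2. h (w e)) \<le> opt_gain \<kappa> (card V)"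
              using V False pos two three four by (intro clean_multigraph_gain[OF gf]) (auto simp: m_def)
            moreover have "0 \<le> slack (card V)" by (simp add: slack_def)
            ultimately show ?thesis by simp
          qed
        qed
      qed
    qed
  qed
qed

section \<open>The extremal multigraphs\<close>

lemma ln_ratio_antimono:
  assumes "1 \<le> w" "w \<le> w'"
  shows "ln (real w' + 1) - ln (real w') \<le> ln (real w + 1) - ln (real w)"
proof -
  have "(real w' + 1) * real w \<le> (real w + 1) * real w'" using assms by (simp add: algebra_simps)
  then have "ln ((real w' + 1) * real w) \<le> ln ((real w + 1) * real w')"
    using assms by (intro ln_mono) auto
  then show ?thesis using assms by (simp add: ln_mult)
qed

text \<open>Concavity of the logarithm: its secant through \<open>a\<close> and \<open>a + 1\<close>
  lies above it at every positive integer. Unit steps away from \<open>a\<close>, in either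
  direction, are compared by \<open>ln_ratio_antimono\<close>.\<close>

lemma ln_secant:
  assumes "1 \<le> a" "1 \<le> w"
  shows "ln (real w) - ln (real a) \<le> (real w - real a) * (ln (real a + 1) - ln (real a))"
proof (cases "a \<le> w")
  case True
  then show ?thesis
  proof (induction w rule: dec_induct)
    case (step w)
    then show ?case using ln_ratio_antimono[of a w] assms by (simp add: algebra_simps)
  qed simp
next
  case False
  then have "w \<le> a" by simp
  then show ?thesis using assms(2)
  proof (induction w rule: inc_induct)
    case (step w)
    then show ?case using ln_ratio_antimono[of w a] by (simp add: algebra_simps)
  qed simp
qed

text \<open>The constant is dictated by a = 2. For larger \<open>a\<close> the ratio is at most 3/2:
  the two logarithmic differences differ by at most 1/(r^2 - 1) \<le> 1/(2 (r + 1)), and 1/(r + 1)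
  is a lower bound for the smaller one.\<close>

lemma ln_ratio_bound:
  assumes "2 \<le> (a :: nat)"
  shows "ln (real a) - ln (real a - 1) \<le> 12 / 7 * (ln (real a + 1) - ln (real a))"
proof (cases "a = 2")
  case True
  have "ln ((2::real) ^ 19) \<le> ln (3 ^ 12)" by (intro ln_mono) auto
  then have "19 * ln 2 \<le> 12 * ln (3::real)" by (simp only: ln_realpow of_nat_numeral zero_less_numeral)
  then show ?thesis using True by simp
next
  case False
  define r where "r = real a"
  have r: "3 \<le> r" using assms False by (simp add: r_def)
  have "1 / (r + 1) \<le> ln (r + 1) - ln r"
  proof -
    have "ln (r / (r + 1)) \<le> r / (r + 1) - 1" using r by (intro ln_le_minus_one) auto
    moreover have "r / (r + 1) - 1 = - (1 / (r + 1))" using r by (simp add: field_simps)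
    ultimately show ?thesis using r by (simp add: ln_div)
  qed
  moreover have "(ln r - ln (r - 1)) - (ln (r + 1) - ln r) \<le> 1 / 2 * (1 / (r + 1))"
  proof -
    have "(ln r - ln (r - 1)) - (ln (r + 1) - ln r) = ln (r * r / ((r - 1) * (r + 1)))"
      using r by (simp add: ln_div ln_mult)
    also have "\<dots> \<le> r * r / ((r - 1) * (r + 1)) - 1" using r by (intro ln_le_minus_one) auto
    also have "\<dots> = 1 / (r - 1) * (1 / (r + 1))"
      using r by (simp add: divide_simps) (simp add: algebra_simps)
    also have "\<dots> \<le> 1 / 2 * (1 / (r + 1))" using r by (intro mult_right_mono) (auto simp: field_simps)
    finally show ?thesis .
  qed
  moreover have "0 \<le> 1 / (r + 1)" using r by simp
  moreover define d p where "d = ln (r + 1) - ln r" and "p = 1 / (r + 1)"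
  ultimately have "p \<le> d" "ln r - ln (r - 1) - d \<le> 1 / 2 * p" "0 \<le> p" by simp_all
  then show ?thesis unfolding r_def[symmetric] d_def[symmetric] by linarith
qed

section \<open>The two-part construction, its representatives and its 6-sets\<close>

definition T_graph :: "nat \<Rightarrow> nat \<Rightarrow> nat \<Rightarrow> nat multigraph" where
  "T_graph a n x = ({1..n}, \<lambda>e\<in>nsets {1..n} 2.
    if e \<subseteq> {1..x} then a - 1 else if e \<subseteq> {x<..n} then a else a + 1)"

lemma nsets_greaterThanAtMost_not_subset:
  assumes "e \<in> nsets {x<..n :: nat} 2"
  shows "\<not> e \<subseteq> {1..x}"
proof
  assume "e \<subseteq> {1..x}"
  moreover have "e \<subseteq> {x<..n}" "card e = 2" using assms by (auto simp: nsets_def)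
  ultimately have "e \<subseteq> {}" by fastforce
  then show False using \<open>card e = 2\<close> by simp
qed

lemma T_graph_in_T_graphs:
  assumes "x \<le> n"
  shows "T_graph a n x \<in> T_graphs 2 1 a n"
proof -
  define V where "V = (\<lambda>i::nat. if i = 0 then {1..x} else {x<..n})"
  have V: "V 0 = {1..x}" "V (Suc 0) = {x<..n}" by (auto simp: V_def)
  have lt2: "(\<forall>i<2. P i) \<longleftrightarrow> P 0 \<and> P (Suc 0)" for P by (auto simp: less_2_cases_iff)
  have "disjoint_family_on V {..<2}" by (auto simp: disjoint_family_on_def V_def)
  moreover have "(\<Union>i<2. V i) = {1..n}" using assms by (auto simp: V_def less_2_cases_iff)
  moreover have "\<forall>e\<in>nsets (V 0) 2. mult (T_graph a n x) e = a - 1"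
    using assms by (auto simp: T_graph_def V nsets_def)
  moreover have "\<forall>e\<in>nsets (V 1) 2. mult (T_graph a n x) e = a"
    using assms nsets_greaterThanAtMost_not_subset[of _ x n] by (auto simp: T_graph_def V nsets_def)
  moreover have "\<forall>e\<in>nsets {1..n} 2. (\<forall>i<2. \<not> e \<subseteq> V i) \<longrightarrow> mult (T_graph a n x) e = a + 1"
    unfolding lt2 V by (auto simp: T_graph_def)
  moreover have "{1..<2} = {1 :: nat}" by auto
  ultimately show ?thesis
    unfolding T_graphs_def mem_Collect_eq
    by (intro conjI exI[of _ V]) (simp_all add: T_graph_def multigraph_def finite_imp_finite_nsets)
qed

lemma T_graphsE:
  assumes "G \<in> T_graphs 2 1 a n"
  obtains A B where "A \<inter> B = {}" "A \<union> B = {1..n}"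
    "\<And>e. e \<in> nsets A 2 \<Longrightarrow> mult G e = a - 1" "\<And>e. e \<in> nsets B 2 \<Longrightarrow> mult G e = a"
    "\<And>p q. p \<in> A \<Longrightarrow> q \<in> B \<Longrightarrow> mult G {p, q} = a + 1"
proof -
  have lt2: "(\<forall>i<2. P i) \<longleftrightarrow> P 0 \<and> P (Suc 0)" for P by (auto simp: less_2_cases_iff)
  obtain V :: "nat \<Rightarrow> nat set" where disj: "disjoint_family_on V {..<2}" and un: "(\<Union>i<2. V i) = {1..n}"
    and V0: "\<forall>e\<in>nsets (V 0) 2. mult G e = a - 1" and V1: "\<forall>i\<in>{1..<2}. \<forall>e\<in>nsets (V i) 2. mult G e = a"
    and cross: "\<forall>e\<in>nsets {1..n} 2. (\<forall>i<2. \<not> e \<subseteq> V i) \<longrightarrow> mult G e = a + 1"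
    using assms unfolding T_graphs_def by blast
  have d: "V 0 \<inter> V 1 = {}" using disj by (auto simp: disjoint_family_on_def)
  have u: "V 0 \<union> V 1 = {1..n}" using un by (auto simp: lessThan_nat_numeral lessThan_Suc)
  show ?thesis
  proof (rule that[OF d u])
    show "mult G e = a - 1" if "e \<in> nsets (V 0) 2" for e using V0 that by blast
    show "mult G e = a" if "e \<in> nsets (V 1) 2" for e using V1 that by auto
    fix p q assume pq: "p \<in> V 0" "q \<in> V 1"
    then have "{p, q} \<in> nsets {1..n} 2" using d u by (auto simp: nsets_def card_insert_if)
    moreover have "\<forall>i<2. \<not> {p, q} \<subseteq> V i" unfolding lt2 using d pq by auto
    ultimately show "mult G {p, q} = a + 1" using cross by blast
  qed
qed

text \<open>This is the origin of the 7: a 6-set with p vertices in \<open>V\<^sub>0\<close> has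
  edge sum 15a + p (6 - p) - p (p - 1)/2, and the maximum, at p = 2, is 15a + 7.\<close>

lemma T_graphs_subset_sq_graphs:
  assumes "1 \<le> a"
  shows "T_graphs 2 1 a n \<subseteq> sq_graphs n 6 (15 * a + 7)"
proof
  fix G assume G: "G \<in> T_graphs 2 1 a n"
  obtain A B where AB: "A \<inter> B = {}" "A \<union> B = {1..n}"
    "\<And>e. e \<in> nsets A 2 \<Longrightarrow> mult G e = a - 1" "\<And>e. e \<in> nsets B 2 \<Longrightarrow> mult G e = a"
    "\<And>p q. p \<in> A \<Longrightarrow> q \<in> B \<Longrightarrow> mult G {p, q} = a + 1"
    using T_graphsE[OF G] by blast
  have "edge_sum G X \<le> 15 * a + 7" if X: "X \<in> nsets {1..n} 6" for X
  proof -
    define P where "P = X \<inter> A"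
    define Q where "Q = X \<inter> B"
    have PQ: "finite P" "finite Q" "P \<inter> Q = {}" "P \<union> Q = X"
      using X AB(1,2) by (auto simp: P_def Q_def nsets_def)
    have c6: "card P + card Q = 6"
      using X PQ card_Un_disjoint[of P Q] by (simp add: nsets_def)
    have "(\<Sum>e\<in>nsets P 2. mult G e) = (\<Sum>e\<in>nsets P 2. a - 1)"
      by (intro sum.cong AB(3)) (auto simp: nsets_def P_def)
    moreover have "(\<Sum>e\<in>nsets Q 2. mult G e) = (\<Sum>e\<in>nsets Q 2. a)"
      by (intro sum.cong AB(4)) (auto simp: nsets_def Q_def)
    moreover have "(\<Sum>x\<in>P. \<Sum>y\<in>Q. mult G {x, y}) = (\<Sum>x\<in>P. \<Sum>y\<in>Q. a + 1)"
      by (intro sum.cong AB(5)) (auto simp: P_def Q_def)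
    ultimately have "edge_sum G X = (card P * (card P - 1) div 2) * (a - 1)
        + (card Q * (card Q - 1) div 2) * a + card P * (card Q * (a + 1))"
      unfolding edge_sum_def PQ(4)[symmetric] using sum_nsets_Un[OF PQ(1-3), of "mult G"]
      by (simp add: card_nsets choose_two)
    \<comment> \<open>Writing \<open>a\<close> as a successor removes the truncated subtraction,
      after which the seven values of \<open>card P\<close> are checked.\<close>
    moreover obtain b where "a = Suc b" using assms not0_implies_Suc by force
    moreover have "card P \<in> {0, 1, 2, 3, 4, 5, 6}" using c6 by auto
    moreover have "card Q = 6 - card P" using c6 by simp
    ultimately show ?thesis by auto
  qed
  then show "G \<in> sq_graphs n 6 (15 * a + 7)"
    using G unfolding sq_graphs_def T_graphs_def by blast
qed

section \<open>Comparison of the two maxima through logarithms\<close>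

theorem theorem3p7:
  fixes a n :: nat
  assumes "a \<ge> 2" and "n \<ge> 503"
  shows "ex_Pi n 6 ((6 choose 2) * a + 7) = Pi_T 2 1 a n"
proof -
  define u where "u = ln (real a + 1) - ln (real a)"
  define \<kappa> where "\<kappa> = (ln (real a) - ln (real a - 1)) / u"
  define h where "h = (\<lambda>w :: nat. (ln (real w) - ln (real a)) / u)"
  have u: "0 < u" unfolding u_def using assms by simp
  have gf: "gain_function a \<kappa> h"
    unfolding gain_function_def
  proof (intro conjI allI impI)
    show "1 \<le> \<kappa>"
      using ln_ratio_antimono[of "a - 1" a] assms u
      unfolding \<kappa>_def u_def by (simp add: of_nat_diff le_divide_eq)
    show "\<kappa> \<le> 12 / 7"
      using ln_ratio_bound[OF assms(1)] u unfolding \<kappa>_def u_def by (simp add: divide_le_eq)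
    show "h w \<le> real w - real a" if "1 \<le> w" for w
      using ln_secant[of a w] that assms u unfolding h_def u_def by (simp add: divide_le_eq)
    show "h w \<le> - \<kappa>" if "1 \<le> w" "w < a" for w
    proof -
      have "ln (real w) \<le> ln (real a - 1)" using that by (intro ln_mono) auto
      then show ?thesis using u unfolding h_def \<kappa>_def by (simp add: field_simps)
    qed
  qed
  have hv: "h a = 0" "h (a + 1) = 1" "h (a - 1) = - \<kappa>"
    using u assms unfolding h_def \<kappa>_def by (simp_all add: u_def of_nat_diff field_simps)
  have six: "(6 choose 2) * a + 7 = 15 * a + 7" by (simp add: choose_two)
  define gain where "gain = (\<lambda>G :: nat multigraph. \<Sum>e\<in>nsets {1..n} 2. h (mult G e))"
  \<comment> \<open>The logarithm of the product is an increasing affine function of the gain, so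
    comparing gains compares products of positive multiplicities.\<close>
  have ln_P: "ln (real (edge_prod G)) = real (n choose 2) * ln (real a) + u * gain G"
    if G: "verts G = {1..n}" "\<And>e. e \<in> nsets {1..n} 2 \<Longrightarrow> 1 \<le> mult G e" for G
  proof -
    have "ln (real (edge_prod G)) = (\<Sum>e\<in>nsets {1..n} 2. ln (real (mult G e)))"
      unfolding edge_prod_def G(1) of_nat_prod
      using G(2) by (intro ln_prod finite_imp_finite_nsets) (fastforce)+
    also have "\<dots> = (\<Sum>e\<in>nsets {1..n} 2. ln (real a) + u * h (mult G e))"
      using u unfolding h_def by (intro sum.cong) auto
    also have "\<dots> = real (n choose 2) * ln (real a) + u * gain G"
      unfolding gain_def sum.distrib sum_distrib_left[symmetric] by (simp add: card_nsets)
    finally show ?thesis .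
  qed
  have T_pos: "1 \<le> mult (T_graph a n x) e" if "e \<in> nsets {1..n} 2" for x e
    using that assms by (auto simp: T_graph_def)
  have T_gain: "gain (T_graph a n x) = split_gain \<kappa> n x" if "x \<le> n" for x
  proof -
    let ?w = "mult (T_graph a n x)"
    have Un: "{1..x} \<union> {x<..n} = {1..n}" using that by auto
    have "(\<Sum>e\<in>nsets {1..x} 2. h (?w e)) = (\<Sum>e\<in>nsets {1..x} 2. - \<kappa>)"
      using that hv by (intro sum.cong) (auto simp: T_graph_def nsets_def)
    moreover have "(\<Sum>e\<in>nsets {x<..n} 2. h (?w e)) = (\<Sum>e\<in>nsets {x<..n} 2. 0)"
    proof (intro sum.cong refl)
      fix e assume e: "e \<in> nsets {x<..n} 2"
      then show "h (?w e) = 0" using nsets_greaterThanAtMost_not_subset[OF e] hv by (auto simp: T_graph_def nsets_def)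
    qed
    moreover have "(\<Sum>p\<in>{1..x}. \<Sum>q\<in>{x<..n}. h (?w {p, q})) = (\<Sum>p\<in>{1..x}. \<Sum>q\<in>{x<..n}. 1)"
      using that hv by (intro sum.cong) (auto simp: T_graph_def nsets_def card_insert_if)
    ultimately have "gain (T_graph a n x) = - (real (x choose 2) * \<kappa>) + real x * real (n - x)"
      unfolding gain_def using sum_nsets_Un[of "{1..x}" "{x<..n}" "\<lambda>e. h (?w e)"]
      by (simp only: Un) (simp add: card_nsets ivl_disj_int)
    moreover have "real (x choose 2) = real x * (real x - 1) / 2"
      by (simp add: choose_two real_of_nat_div algebra_simps of_nat_diff)
    ultimately show ?thesis using that by (simp add: split_gain_def of_nat_diff algebra_simps)
  qed
  have P_le: "edge_prod G \<le> Pi_T 2 1 a n" if G: "G \<in> sq_graphs n 6 (15 * a + 7)" for G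
  \<comment> \<open>A pair of multiplicity 0 makes the product vanish. It is treated apart because
    the gain bounds concern positive multiplicities only.\<close>
  proof (cases "\<forall>e\<in>nsets {1..n} 2. 1 \<le> mult G e")
    case False
    then have "edge_prod G = 0"
      using G unfolding edge_prod_def sq_graphs_def by (force simp: finite_imp_finite_nsets)
    then show ?thesis by simp
  next
    case True
    have vG: "verts G = {1..n}" using G by (simp add: sq_graphs_def)
    have pos: "0 < edge_prod G" using True vG unfolding edge_prod_def by (intro prod_pos) force
    have "gain G \<le> opt_gain \<kappa> (card {1..n}) + slack (card {1..n})"
      unfolding gain_def
    proof (rule gain_le_opt_plus_slack[OF gf])
      fix X assume "X \<subseteq> {1..n}" "card X = 6"
      then have "X \<in> nsets {1..n} 6" using finite_subset[of X "{1..n}"] by (simp add: nsets_def)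
      then show "(\<Sum>e\<in>nsets X 2. mult G e) \<le> 15 * a + 7"
        using G unfolding sq_graphs_def edge_sum_def by blast
    qed (use True assms in auto)
    moreover have "slack n = 0"
      using power_mono[of 503 "real n" 2] assms by (simp add: slack_def)
    moreover obtain x where x: "x \<le> n" "opt_gain \<kappa> n = split_gain \<kappa> n x"
      by (rule opt_gain_attained[of \<kappa> n]) (use gain_functionD(1)[OF gf] in auto)
    ultimately have "gain G \<le> gain (T_graph a n x)" using T_gain by simp
    then have "ln (real (edge_prod G)) \<le> ln (real (edge_prod (T_graph a n x)))"
      using ln_P[of G] ln_P[of "T_graph a n x"] True vG T_pos u by (simp add: T_graph_def)
    moreover have "0 < edge_prod (T_graph a n x)"
    proof -
      have "verts (T_graph a n x) = {1..n}" by (simp add: T_graph_def)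
      then show ?thesis using T_pos unfolding edge_prod_def by (intro prod_pos) (simp add: Suc_le_eq)
    qed
    ultimately have "edge_prod G \<le> edge_prod (T_graph a n x)" using pos by simp
    also have "\<dots> \<le> Pi_T 2 1 a n"
      unfolding Pi_T_def using T_graph_in_T_graphs[OF x(1)] finite_T_graphs by (intro Max_ge) auto
    finally show ?thesis .
  qed
  \<comment> \<open>Here 6 \<le> n is used; without finiteness \<open>Max\<close> would be
    unspecified.\<close>
  have fin: "finite (sq_graphs n 6 (15 * a + 7))" using assms by (intro finite_sq_graphs) auto
  show ?thesis unfolding six
  proof (rule antisym)
    show "ex_Pi n 6 (15 * a + 7) \<le> Pi_T 2 1 a n"
      unfolding ex_Pi_def using fin sq_graphs_nonempty P_le by (intro Max.boundedI) auto
    show "Pi_T 2 1 a n \<le> ex_Pi n 6 (15 * a + 7)"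
      unfolding ex_Pi_def Pi_T_def
      using fin T_graphs_nonempty T_graphs_subset_sq_graphs assms by (intro Max_mono image_mono) auto
  qed
qed

end
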